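(* Let $0\le a<b$, $J=[a,b]$, $J'=(a,b]$, let $\varphi\in C^{1}(J,\mathbb{R})$ be an increasing function with $\varphi'(t)\neq 0$ for all $t\in J$, let $1<\mu<2$, $0\le\nu\le 1$, $\xi=\mu+\nu(2-\mu)$. Let $m\ge 1$, $\delta_i>0$ and $\lambda_i\in\mathbb{R}$ for $i=1,\dots,m$, and $a\le\tau_1<\tau_2<\cdots<\tau_m\le b$, be such that $$\Lambda:=\frac{(\varphi(b)-\varphi(a))^{\xi-1}}{\Gamma(\xi)}-\sum_{i=1}^{m}\frac{\lambda_i}{\Gamma(\xi+\delta_i)}(\varphi(\tau_i)-\varphi(a))^{\xi+\delta_i-1}\neq 0 .$$ Let $f:J'\times\mathbb{R}\times\mathbb{R}\to\mathbb{R}$ be a continuous function such that $f\big(\cdot,y(\cdot),{}^{H}\mathcal{D}^{\mu,\nu;\varphi}_{a+}y(\cdot)\big)\in C_{2-\xi;\varphi}(J,\mathbb{R})$ for each $y\in C_{2-\xi;\varphi}(J,\mathbb{R})$. Then the nonlocal boundary value problem $${}^{H}\mathcal{D}^{\mu,\nu;\varphi}_{a+}y(t)=f\big(t,y(t),{}^{H}\mathcal{D}^{\mu,\nu;\varphi}_{a+}y(t)\big),\quad t\in J',\qquad y(a)=0,\qquad y(b)=\sum_{i=1}^{m}\lambda_i\,\mathcal{I}_{a+}^{\delta_i;\varphi}y(\tau_i)$$ (for $y\in C_{2-\xi;\varphi}(J,\mathbb{R})$) is equivalent to the fractional integral equation $$y(t)=(\varphi(t)-\varphi(a))^{\xi-1}\tilde{A}_y+\mathcal{I}_{a+}^{\mu;\varphi}g_y(t),$$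 where $g_y\in C_{2-\xi;\varphi}(J,\mathbb{R})$ satisfies the functional equation $$g_y(t)=f\Big(t,\,(\varphi(t)-\varphi(a))^{\xi-1}\tilde{A}_y+\mathcal{I}_{a+}^{\mu;\varphi}g_y(t),\,g_y(t)\Big),\qquad t\in J',$$ and $$\tilde{A}_y=\frac{1}{\Lambda\,\Gamma(\xi)}\left[\sum_{i=1}^{m}\lambda_i\,\mathcal{I}_{a+}^{\mu+\delta_i;\varphi}g_y(\tau_i)-\mathcal{I}_{a+}^{\mu;\varphi}g_y(b)\right].$$ That is, $y$ solves the boundary value problem if and only if there is such a $g_y$ for which $y$ is given by the integral equation.
   Context: The weighted space is $$C_{2-\xi;\varphi}(J,\mathbb{R})=\{\mathfrak{h}:(a,b]\to\mathbb{R}\;:\;(\varphi(t)-\varphi(a))^{2-\xi}\mathfrak{h}(t)\in C(J,\mathbb{R})\},$$ meaning that the weighted function extends continuously to $[a,b]$, with norm $\|\mathfrak{h}\|=\max_{t\in J}|(\varphi(t)-\varphi(a))^{2-\xi}\mathfrak{h}(t)|$. For $\alpha>0$ the $\varphi$-Riemann--Liouville fractional integral is $$\mathcal{I}_{a+}^{\alpha;\varphi}\mathfrak{h}(t)=\frac{1}{\Gamma(\alpha)}\int_a^t\varphi'(s)(\varphi(t)-\varphi(s))^{\alpha-1}\mathfrak{h}(s)\,ds,$$ with $\mathcal{I}_{a+}^{0;\varphi}$ the identity; $\mathcal{I}_{a+}^{\alpha;\varphi}\mathfrak{h}(\tau)$ denotes its value at $t=\tau$. For $n-1<\mu<n$,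 $n\in\mathbb{N}$ (here $n=2$) and $0\le\nu\le1$, the $\varphi$-Hilfer fractional derivative of order $\mu$ and type $\nu$ is $${}^{H}\mathcal{D}_{a+}^{\mu,\nu;\varphi}\mathfrak{h}(t)=\mathcal{I}_{a+}^{\nu(n-\mu);\varphi}\left(\frac{1}{\varphi'(t)}\frac{d}{dt}\right)^{n}\mathcal{I}_{a+}^{(1-\nu)(n-\mu);\varphi}\mathfrak{h}(t),$$ for functions for which the right-hand side is defined. The value $y(a)$ is understood as $\lim_{t\to a+}y(t)$. $\Gamma$ is the Gamma function.
   Formalization: For ν > 0 the equivalence is stated only for those y whose Hilfer derivative is defined on (a,b]; without this the converse fails, since a continuous g_y need not make y regular enough. The condition on f is required only for y whose Hilfer derivative is defined. *)

theory Defs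
  imports "HOL-Analysis.Analysis"
begin

text \<open>
  Functions on the half-open interval \<open>(a, b]\<close> are total functions of which only the values on
  \<open>{a<..b}\<close> matter. The argument \<open>\<phi>'\<close> is the derivative of \<open>\<phi>\<close> on \<open>[a, b]\<close>.
\<close>

definition weighted_space :: "(real \<Rightarrow> real) \<Rightarrow> real \<Rightarrow> real \<Rightarrow> real \<Rightarrow> (real \<Rightarrow> real) set" where
  "weighted_space \<phi> a b \<gamma> =
     {h. \<exists>u. continuous_on {a..b} u \<and> (\<forall>t\<in>{a<..b}. u t = (\<phi> t - \<phi> a) powr \<gamma> * h t)}"

definition frac_integral ::
  "(real \<Rightarrow> real) \<Rightarrow> (real \<Rightarrow> real) \<Rightarrow> real \<Rightarrow> real \<Rightarrow> (real \<Rightarrow> real) \<Rightarrow> real \<Rightarrow> real" where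
  "frac_integral \<phi> \<phi>' a \<alpha> h t =
     (if \<alpha> = 0 then h t
      else 1 / Gamma \<alpha> * (LBINT s:{a<..<t}. \<phi>' s * (\<phi> t - \<phi> s) powr (\<alpha> - 1) * h s))"

text \<open>Bochner integrals default to 0, so existence of the fractional integral is stated separately.\<close>

definition frac_integral_exists ::
  "(real \<Rightarrow> real) \<Rightarrow> (real \<Rightarrow> real) \<Rightarrow> real \<Rightarrow> real \<Rightarrow> (real \<Rightarrow> real) \<Rightarrow> real \<Rightarrow> bool" where
  "frac_integral_exists \<phi> \<phi>' a \<alpha> h t \<longleftrightarrow>
     \<alpha> = 0 \<or> set_integrable lborel {a<..<t} (\<lambda>s. \<phi>' s * (\<phi> t - \<phi> s) powr (\<alpha> - 1) * h s)"

text \<open>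
  Iterates of \<open>(1 / \<phi>'(t)) d/dt\<close> on \<open>(a, b]\<close>; the derivative at \<open>b\<close> is the left-sided one.
\<close>

primrec phi_deriv ::
  "(real \<Rightarrow> real) \<Rightarrow> real \<Rightarrow> real \<Rightarrow> nat \<Rightarrow> (real \<Rightarrow> real) \<Rightarrow> real \<Rightarrow> real" where
  "phi_deriv \<phi>' a b 0 h = h"
| "phi_deriv \<phi>' a b (Suc n) h =
     (\<lambda>t. 1 / \<phi>' t * vector_derivative (phi_deriv \<phi>' a b n h) (at t within {a<..b}))"

definition phi_deriv_exists ::
  "(real \<Rightarrow> real) \<Rightarrow> real \<Rightarrow> real \<Rightarrow> nat \<Rightarrow> (real \<Rightarrow> real) \<Rightarrow> bool" where
  "phi_deriv_exists \<phi>' a b n h \<longleftrightarrow>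
     (\<forall>k<n. \<forall>t\<in>{a<..b}. phi_deriv \<phi>' a b k h differentiable (at t within {a<..b}))"

definition hilfer_deriv ::
  "(real \<Rightarrow> real) \<Rightarrow> (real \<Rightarrow> real) \<Rightarrow> real \<Rightarrow> real \<Rightarrow> nat \<Rightarrow> real \<Rightarrow> real \<Rightarrow>
   (real \<Rightarrow> real) \<Rightarrow> real \<Rightarrow> real" where
  "hilfer_deriv \<phi> \<phi>' a b n \<mu> \<nu> h =
     frac_integral \<phi> \<phi>' a (\<nu> * (real n - \<mu>))
       (phi_deriv \<phi>' a b n (frac_integral \<phi> \<phi>' a ((1 - \<nu>) * (real n - \<mu>)) h))"

text \<open>The right-hand side of the definition of the Hilfer derivative is defined on \<open>(a, b]\<close>.\<close>

definition hilfer_deriv_exists ::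
  "(real \<Rightarrow> real) \<Rightarrow> (real \<Rightarrow> real) \<Rightarrow> real \<Rightarrow> real \<Rightarrow> nat \<Rightarrow> real \<Rightarrow> real \<Rightarrow>
   (real \<Rightarrow> real) \<Rightarrow> bool" where
  "hilfer_deriv_exists \<phi> \<phi>' a b n \<mu> \<nu> h \<longleftrightarrow>
     (let w = frac_integral \<phi> \<phi>' a ((1 - \<nu>) * (real n - \<mu>)) h in
        (\<forall>t\<in>{a<..b}. frac_integral_exists \<phi> \<phi>' a ((1 - \<nu>) * (real n - \<mu>)) h t) \<and>
        phi_deriv_exists \<phi>' a b n w \<and>
        (\<forall>t\<in>{a<..b}. frac_integral_exists \<phi> \<phi>' a (\<nu> * (real n - \<mu>)) (phi_deriv \<phi>' a b n w) t))"

end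

theory Submission imports Defs begin

text \<open>
  Put \<open>X(t) = \<phi>(t) - \<phi>(a)\<close> and \<open>v = (1/\<phi>' d/dt)\<^sup>2 I\<^bsup>2-\<xi>\<^esup> y\<close>. If the Hilfer derivative of \<open>y\<close> exists, then
  \<open>v\<close> is integrable, so \<open>I\<^bsup>2-\<xi>\<^esup> y = c\<^sub>0 + c\<^sub>1 X + I\<^sup>2 v\<close>, and \<open>y(a) = 0\<close> forces \<open>c\<^sub>0 = 0\<close>. Applying
  \<open>I\<^bsup>\<xi>-1\<^esup>\<close> and differentiating gives \<open>y = C X\<^bsup>\<xi>-1\<^esup> + I\<^bsup>\<xi>\<^esup> v\<close>. If \<open>g = I\<^bsup>\<xi>-\<mu>\<^esup> v\<close> is the Hilfer
  derivative, this is \<open>y = C X\<^bsup>\<xi>-1\<^esup> + I\<^bsup>\<mu>\<^esup> g\<close>, and the condition at \<open>b\<close> is a linear equation for \<open>C\<close>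
  with coefficient \<open>\<Lambda> \<Gamma>(\<xi>)\<close>.

  Conversely, let \<open>y = A X\<^bsup>\<xi>-1\<^esup> + I\<^bsup>\<mu>\<^esup> g\<close>. For \<open>\<nu> = 0\<close> one differentiates \<open>I\<^bsup>2-\<mu>\<^esup> y\<close> directly. For
  \<open>\<nu> > 0\<close>, comparison with \<open>y = C X\<^bsup>\<xi>-1\<^esup> + I\<^bsup>\<xi>\<^esup> v\<close> near \<open>a\<close> gives \<open>A = C\<close> and hence
  \<open>I\<^sup>1 g = I\<^bsup>1+\<xi>-\<mu>\<^esup> v\<close>. As \<open>v\<close> is merely integrable, this identifies \<open>g\<close> with \<open>I\<^bsup>\<xi>-\<mu>\<^esup> v\<close> only
  almost everywhere at first; equality at every point comes from the left difference quotients of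
  \<open>I\<^bsup>1+\<beta>\<^esup> v\<close>, which converge to \<open>I\<^bsup>\<beta>\<^esup> v\<close> wherever the latter integral converges absolutely.
\<close>

section \<open>Preliminaries on real functions\<close>

lemma set_integrable_mult_bounded_continuous:
  fixes f g :: "real \<Rightarrow> real"
  assumes "set_integrable lborel {c<..<d} f" "continuous_on {c<..<d} g"
    and "\<And>s. s \<in> {c<..<d} \<Longrightarrow> \<bar>g s\<bar> \<le> M"
  shows "set_integrable lborel {c<..<d} (\<lambda>s. g s * f s)"
proof -
  have g: "(\<lambda>s. indicator {c<..<d} s *\<^sub>R g s) \<in> borel_measurable borel"
    by (intro borel_measurable_continuous_on_indicator assms) auto
  have f: "(\<lambda>s. indicator {c<..<d} s *\<^sub>R f s) \<in> borel_measurable borel"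
    using assms(1) by (auto simp: set_integrable_def dest: borel_measurable_integrable)
  have "(\<lambda>s. (indicator {c<..<d} s *\<^sub>R g s) * (indicator {c<..<d} s *\<^sub>R f s)) \<in> borel_measurable borel"
    using g f by simp
  also have "(\<lambda>s. (indicator {c<..<d} s *\<^sub>R g s) * (indicator {c<..<d} s *\<^sub>R f s)) =
      (\<lambda>s. indicator {c<..<d} s *\<^sub>R (g s * f s))"
    by (auto simp: indicator_def)
  finally have "set_borel_measurable lborel {c<..<d} (\<lambda>s. g s * f s)"
    by (simp add: set_borel_measurable_def)
  moreover have "set_integrable lborel {c<..<d} (\<lambda>s. M * f s)"
    using assms(1) by simp
  moreover have "norm (g s * f s) \<le> norm (M * f s)" if "s \<in> {c<..<d}" for s
    using assms(3)[OF that] by (auto simp: abs_mult intro!: mult_right_mono)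
  ultimately show ?thesis
    by (blast intro: set_integrable_bound AE_I2)
qed

lemma Gamma_real_nonzero: "x > 0 \<Longrightarrow> Gamma (x::real) \<noteq> 0"
  by (metis Gamma_real_pos less_irrefl)

text \<open>With r = h / A < 1 the upper bound amounts to 1 - r \<le> (1 - r)^\<beta>, true since
  \<beta> \<le> 1; for h \<ge> A only A^\<beta> / h \<le> A^(\<beta> - 1) remains. As the bound is
  free of h, it supplies the majorant for dominated convergence in
  \<open>I_left_derivative\<close>.\<close>

lemma powr_quotient:
  fixes A h \<beta> :: real
  assumes "A > 0" "h > 0" "0 < \<beta>" "\<beta> \<le> 1"
  defines "Q \<equiv> (A powr \<beta> - (if h < A then (A - h) powr \<beta> else 0)) / h"
  shows "\<bar>Q\<bar> \<le> A powr (\<beta> - 1)"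
proof -
  have A: "A powr \<beta> = A * A powr (\<beta> - 1)" using assms by (simp add: powr_diff)
  have "0 \<le> Q" unfolding Q_def using assms by (auto intro!: divide_nonneg_pos powr_mono2)
  moreover have "Q \<le> A powr (\<beta> - 1)"
  proof (cases "h < A")
    case True
    define r where "r = h / A"
    have r: "0 < r" "r < 1" "A - h = A * (1 - r)" using assms True by (auto simp: r_def field_simps)
    have "(1 - r) powr 1 \<le> (1 - r) powr \<beta>" using r assms by (intro powr_mono') auto
    hence "A powr \<beta> * (1 - r) \<le> (A - h) powr \<beta>"
      using r assms by (simp add: powr_mult)
    also have "A powr \<beta> * (1 - r) = A powr \<beta> - h * A powr (\<beta> - 1)"
      using A assms by (simp add: r_def field_simps)
    finally show ?thesis using True assms by (simp add: Q_def field_simps)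
  next
    case False
    thus ?thesis using A assms by (simp add: Q_def field_simps mult_right_mono)
  qed
  ultimately show ?thesis by simp
qed

text \<open>Difference quotients of a monotone function are nonnegative, and so is their limit.
  Together with \<open>\<phi>' t \<noteq> 0\<close> this gives the positivity of
  \<open>\<phi>'\<close> that the locale asks for.\<close>

lemma mono_on_has_real_derivative_nonneg:
  fixes f :: "real \<Rightarrow> real"
  assumes "mono_on S f" "(f has_real_derivative D) (at x within S)" "x \<in> S" "at x within S \<noteq> bot"
  shows "D \<ge> 0"
proof (rule tendsto_lowerbound)
  show "((\<lambda>y. (f y - f x) / (y - x)) \<longlongrightarrow> D) (at x within S)"
    using assms(2) by (simp add: has_field_derivative_iff)
  show "eventually (\<lambda>y. 0 \<le> (f y - f x) / (y - x)) (at x within S)"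
    unfolding eventually_at_filter
  proof (intro always_eventually allI impI)
    fix y assume "y \<noteq> x" "y \<in> S"
    thus "0 \<le> (f y - f x) / (y - x)"
      using mono_onD[OF assms(1), of x y] mono_onD[OF assms(1), of y x] assms(3)
      by (cases x y rule: linorder_cases) (auto simp: divide_nonneg_pos divide_nonpos_neg)
  qed
qed (use assms in auto)

section \<open>The substitution function \<open>\<phi>\<close>, its kernels and the Beta
  integral\<close>

locale phi_interval =
  fixes a b :: real and \<phi> \<phi>' :: "real \<Rightarrow> real"
  assumes ab: "a < b"
    and deriv: "t \<in> {a..b} \<Longrightarrow> (\<phi> has_real_derivative \<phi>' t) (at t within {a..b})"
    and cont': "continuous_on {a..b} \<phi>'"
    and pos': "t \<in> {a..b} \<Longrightarrow> \<phi>' t > 0"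
begin

abbreviation I where "I \<equiv> frac_integral \<phi> \<phi>' a"
abbreviation I_exists where "I_exists \<equiv> frac_integral_exists \<phi> \<phi>' a"
abbreviation L1 :: "(real \<Rightarrow> real) \<Rightarrow> bool" where "L1 \<equiv> set_integrable lborel {a<..<b}"

lemma cont: "continuous_on {a..b} \<phi>"
  using deriv by (meson DERIV_continuous continuous_on_eq_continuous_within)

lemma cont_subset: "S \<subseteq> {a..b} \<Longrightarrow> continuous_on S \<phi>" "S \<subseteq> {a..b} \<Longrightarrow> continuous_on S \<phi>'"
  using cont cont' continuous_on_subset by blast+

lemma phi_less: assumes "a \<le> s" "s < t" "t \<le> b" shows "\<phi> s < \<phi> t"
proof (rule DERIV_pos_imp_increasing_open[OF \<open>s < t\<close>])
  fix x assume x: "s < x" "x < t"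
  have "(\<phi> has_real_derivative \<phi>' x) (at x within {a<..<b})"
    using deriv[of x] x assms by (auto intro: DERIV_subset)
  hence "(\<phi> has_real_derivative \<phi>' x) (at x)"
    using x assms by (subst (asm) at_within_open) auto
  thus "\<exists>y. (\<phi> has_real_derivative y) (at x) \<and> 0 < y"
    using pos'[of x] x assms by auto
qed (use cont_subset(1)[of "{s..t}"] assms in auto)

lemma phi_le: "a \<le> s \<Longrightarrow> s \<le> t \<Longrightarrow> t \<le> b \<Longrightarrow> \<phi> s \<le> \<phi> t"
  using phi_less[of s t] by (cases "s = t") auto

lemma phi_neq:
  "s \<in> {a<..<t} \<Longrightarrow> t \<in> {a..b} \<Longrightarrow> \<phi> s \<noteq> \<phi> t"
  "s \<in> {a<..<t} \<Longrightarrow> t \<in> {a..b} \<Longrightarrow> \<phi> t \<noteq> \<phi> s"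
  using phi_less[of s t] by auto

lemma phi'_bounds:
  obtains M where "M > 0" "\<And>t. t \<in> {a..b} \<Longrightarrow> \<phi>' t \<le> M \<and> 1 / \<phi>' t \<le> M"
proof -
  have "continuous_on {a..b} (\<lambda>t. 1 / \<phi>' t)"
    using pos' by (intro continuous_intros cont') (force simp: less_imp_neq)+
  then obtain x where x: "x \<in> {a..b}" "\<And>t. t \<in> {a..b} \<Longrightarrow> 1 / \<phi>' t \<le> 1 / \<phi>' x"
    using continuous_attains_sup[of "{a..b}" "\<lambda>t. 1 / \<phi>' t"] ab by auto
  obtain z where z: "z \<in> {a..b}" "\<And>t. t \<in> {a..b} \<Longrightarrow> \<phi>' t \<le> \<phi>' z"
    using continuous_attains_sup[of "{a..b}" "\<phi>'", OF _ _ cont'] ab by auto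
  show ?thesis
    using x z pos'[OF x(1)] pos'[OF z(1)]
    by (intro that[of "max (\<phi>' z) (1 / \<phi>' x)"]) (auto simp: le_max_iff_disj less_max_iff_disj)
qed

text \<open>Both \<open>\<phi>'\<close> and its reciprocal are continuous and bounded on the compact
  interval, so this weight can be inserted or dropped.\<close>

lemma L1_phi'_iff: "L1 (\<lambda>s. \<phi>' s * h s) \<longleftrightarrow> L1 h"
proof -
  obtain M where M: "\<And>t. t \<in> {a..b} \<Longrightarrow> \<phi>' t \<le> M \<and> 1 / \<phi>' t \<le> M"
    using phi'_bounds by blast
  have n0: "\<phi>' s \<noteq> 0" if "s \<in> {a<..<b}" for s using pos'[of s] that by auto
  show ?thesis
  proof
    assume *: "L1 (\<lambda>s. \<phi>' s * h s)"
    have "L1 (\<lambda>s. 1 / \<phi>' s * (\<phi>' s * h s))"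
      by (rule set_integrable_mult_bounded_continuous[OF *, where M = M])
        (use M n0 pos' in \<open>auto intro!: continuous_intros cont_subset simp: less_imp_le abs_of_pos\<close>)
    also have "?this \<longleftrightarrow> L1 h"
      by (rule set_integrable_cong) (use n0 in auto)
    finally show "L1 h" .
  next
    assume *: "L1 h"
    show "L1 (\<lambda>s. \<phi>' s * h s)"
      by (rule set_integrable_mult_bounded_continuous[OF *, where M = M])
        (use M pos' in \<open>auto intro!: continuous_intros cont_subset simp: abs_of_pos\<close>)
  qed
qed

lemma kernel_continuous:
  assumes "t \<in> {a..b}" shows "continuous_on {a<..<t} (\<lambda>s. (\<phi> t - \<phi> s) powr \<gamma>)"
proof -
  have "\<phi> s \<noteq> \<phi> t" if "s \<in> {a<..<t}" for s using phi_less[of s t] that assms by auto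
  thus ?thesis using assms by (intro continuous_intros cont_subset) (force)+
qed

lemma X_continuous:
  assumes "t \<in> {a..b}" shows "continuous_on {a<..t} (\<lambda>s. (\<phi> s - \<phi> a) powr \<gamma>)"
proof -
  have "\<phi> s \<noteq> \<phi> a" if "s \<in> {a<..t}" for s using phi_less[of a s] that assms by auto
  thus ?thesis using assms by (intro continuous_intros cont_subset) (force)+
qed

text \<open>The kernel of order \<gamma> is the kernel of order \<alpha> times (\<phi>(t) -
  \<phi>(s))^(\<gamma> - \<alpha>), a continuous factor that is bounded because its exponent is
  nonnegative.\<close>

lemma I_exists_mono:
  assumes "I_exists \<alpha> h t" "0 < \<alpha>" "\<alpha> \<le> \<gamma>" "t \<in> {a..b}"
  shows "I_exists \<gamma> h t"
proof -
  have *: "set_integrable lborel {a<..<t} (\<lambda>s. \<phi>' s * (\<phi> t - \<phi> s) powr (\<alpha> - 1) * h s)"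
    using assms by (auto simp: frac_integral_exists_def)
  have "set_integrable lborel {a<..<t}
      (\<lambda>s. (\<phi> t - \<phi> s) powr (\<gamma> - \<alpha>) * (\<phi>' s * (\<phi> t - \<phi> s) powr (\<alpha> - 1) * h s))"
    by (rule set_integrable_mult_bounded_continuous[OF * kernel_continuous, where M = "(\<phi> t - \<phi> a) powr (\<gamma> - \<alpha>)"])
      (use assms phi_le in \<open>auto intro!: powr_mono2\<close>)
  also have "?this \<longleftrightarrow> set_integrable lborel {a<..<t} (\<lambda>s. \<phi>' s * (\<phi> t - \<phi> s) powr (\<gamma> - 1) * h s)"
    by (rule set_integrable_cong) (auto simp flip: powr_add)
  finally show ?thesis by (simp add: frac_integral_exists_def)
qed

lemma I_exists_1_iff: "I_exists 1 h b \<longleftrightarrow> L1 h"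
proof -
  have "I_exists 1 h b \<longleftrightarrow> L1 (\<lambda>s. \<phi>' s * h s)"
    \<comment> \<open>In HOL \<open>0 powr 0 = 0\<close>, so the kernel of order 1 equals 1 only
      where its base is nonzero; \<open>phi_neq\<close> guarantees this on the open
      interval.\<close>
    unfolding frac_integral_exists_def using phi_neq[of _ b] ab
    by (simp only: one_neq_zero simp_thms, intro set_integrable_cong) auto
  thus ?thesis by (simp add: L1_phi'_iff)
qed

lemma L1_imp_I_exists:
  assumes "L1 h" "1 \<le> \<alpha>" "t \<in> {a..b}" shows "I_exists \<alpha> h t"
proof (rule I_exists_mono[of 1])
  have "set_integrable lborel {a<..<t} (\<lambda>s. \<phi>' s * h s)"
    using assms by (intro set_integrable_subset[where A = "{a<..<b}" and B = "{a<..<t}"]) (auto simp: L1_phi'_iff)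
  also have "?this \<longleftrightarrow> set_integrable lborel {a<..<t} (\<lambda>s. \<phi>' s * (\<phi> t - \<phi> s) powr (1 - 1) * h s)"
    using phi_neq[of _ t] assms by (intro set_integrable_cong) auto
  finally show "I_exists 1 h t" by (simp add: frac_integral_exists_def)
qed (use assms in auto)

text \<open>Existence passes from order \<alpha> up to order 1, and at b order 1 means integrability
  over the whole interval. In this way the existence clause of the Hilfer derivative yields
  \<open>L1 v\<close>.\<close>

lemma I_exists_imp_L1:
  assumes "I_exists \<alpha> h b" "0 < \<alpha>" "\<alpha> \<le> 1" shows "L1 h"
  using I_exists_mono[OF assms] ab I_exists_1_iff by auto

text \<open>The substitution x = (\<phi>(r) - \<phi>(s)) / (\<phi>(t) - \<phi>(s)) maps [s, t] onto
  [0, 1] and turns the integral into Euler's Beta integral.\<close>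

lemma beta_kernel:
  assumes st: "a \<le> s" "s < t" "t \<le> b" and "\<alpha> > 0" "\<beta> > 0"
  defines "K \<equiv> (\<lambda>r. \<phi>' r * (\<phi> t - \<phi> r) powr (\<alpha> - 1) * (\<phi> r - \<phi> s) powr (\<beta> - 1))"
  shows "set_integrable lborel {s<..<t} K"
    and "(LBINT r:{s<..<t}. K r) = Beta \<alpha> \<beta> * (\<phi> t - \<phi> s) powr (\<alpha> + \<beta> - 1)"
proof -
  define D where "D = \<phi> t - \<phi> s"
  define G where "G = (\<lambda>r. (\<phi> r - \<phi> s) / D)"
  define f where "f = (\<lambda>x::real. x powr (\<beta> - 1) * (1 - x) powr (\<alpha> - 1))"
  have D: "D > 0" "D \<noteq> 0" using phi_less[OF st] by (simp_all add: D_def)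
  have dG: "(G has_field_derivative \<phi>' r / D) (at r within {s..t})" if "r \<in> {s..t}" for r
    unfolding G_def using DERIV_cdivide[OF DERIV_diff[OF DERIV_subset[OF deriv[of r]] DERIV_const]] that st
    by force
  have inj: "inj_on G {s..t}"
  proof (rule inj_onI)
    fix r u assume "r \<in> {s..t}" "u \<in> {s..t}" "G r = G u"
    thus "r = u"
      using phi_less[of r u] phi_less[of u r] st D by (cases r u rule: linorder_cases) (auto simp: G_def)
  qed
  have im: "G ` {s..t} = {0..1}"
  proof -
    have "continuous_on {s..t} G"
      unfolding G_def using st D by (intro continuous_intros cont_subset) auto
    hence "{G s..G t} \<subseteq> G ` {s..t}"
      using IVT'[of G s _ t] st by (force simp: image_iff)
    moreover have "G ` {s..t} \<subseteq> {0..1}"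
      using phi_le st D by (auto simp: G_def D_def divide_le_eq)
    ultimately show ?thesis using D by (auto simp: G_def D_def)
  qed
  have f_int: "(f has_integral Beta \<beta> \<alpha>) {0..1}"
    using has_integral_Beta_real[of \<beta> \<alpha>] assms by (simp add: f_def)
  hence "f absolutely_integrable_on G ` {s..t} \<and> integral (G ` {s..t}) f = Beta \<beta> \<alpha>"
    unfolding im by (auto simp: f_def intro!: nonnegative_absolutely_integrable_1 dest: has_integral_integrable)
  hence *: "(\<lambda>r. \<bar>\<phi>' r / D\<bar> * f (G r)) absolutely_integrable_on {s..t} \<and>
      integral {s..t} (\<lambda>r. \<bar>\<phi>' r / D\<bar> * f (G r)) = Beta \<beta> \<alpha>"
    by (subst has_absolute_integral_change_of_variables_1'[OF _ dG inj]) auto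
  \<comment> \<open>The exponent of \<open>D\<close> collects -1 from \<open>\<phi>' r / D\<close>
    and 1 - \<alpha>, 1 - \<beta> from the two powers.\<close>
  have eq: "\<bar>\<phi>' r / D\<bar> * f (G r) = K r * D powr (1 - \<alpha> - \<beta>)" if "r \<in> {s<..<t}" for r
  proof -
    have "\<phi> r - \<phi> s > 0" "\<phi> t - \<phi> r > 0" "\<phi>' r > 0" using phi_less[of s r] phi_less[of r t] pos'[of r] that st by auto
    moreover have "1 - G r = (\<phi> t - \<phi> r) / D" using D by (simp add: G_def D_def field_simps)
    moreover have "D powr (1 - \<alpha> - \<beta>) = 1 / (D * (D powr (\<beta> - 1) * D powr (\<alpha> - 1)))"
      using D by (simp add: powr_diff powr_add field_simps)
    ultimately show ?thesis using D unfolding K_def f_def 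
      by (simp add: G_def powr_divide abs_of_pos)
  qed
  have "(\<lambda>r. \<bar>\<phi>' r / D\<bar> * f (G r)) absolutely_integrable_on {s<..<t}"
    using * by (auto intro: set_integrable_subset)
  also have "?this \<longleftrightarrow> (\<lambda>r. K r * D powr (1 - \<alpha> - \<beta>)) absolutely_integrable_on {s<..<t}"
    by (rule set_integrable_cong) (use eq in auto)
  finally have K_abs: "K absolutely_integrable_on {s<..<t}" using D by simp
  \<comment> \<open>Absolute integrability refers to the completed measure; passing to
    \<open>lborel\<close> requires Borel measurability of the cut-off \<open>K\<close>.\<close>
  have "(\<lambda>r. indicator {s<..<t} r *\<^sub>R K r) \<in> borel_measurable borel"
  proof (rule borel_measurable_continuous_on_indicator)
    have "\<phi> r \<noteq> \<phi> s \<and> \<phi> r \<noteq> \<phi> t" if "r \<in> {s<..<t}" for r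
      using phi_less[of s r] phi_less[of r t] that st by auto
    thus "continuous_on {s<..<t} K" unfolding K_def
      using st by (intro continuous_intros cont_subset) force+
  qed auto
  thus K_int: "set_integrable lborel {s<..<t} K"
    using K_abs by (simp add: set_integrable_def integrable_completion)
  have "(LBINT r:{s<..<t}. K r) = integral {s<..<t} K"
    by (rule set_borel_integral_eq_integral[OF K_int])
  also have "\<dots> = integral {s<..<t} (\<lambda>r. D powr (\<alpha> + \<beta> - 1) * (\<bar>\<phi>' r / D\<bar> * f (G r)))"
  proof (rule integral_cong)
    fix r assume "r \<in> {s<..<t}"
    show "K r = D powr (\<alpha> + \<beta> - 1) * (\<bar>\<phi>' r / D\<bar> * f (G r))"
      unfolding eq[OF \<open>r \<in> {s<..<t}\<close>] using D by (simp flip: powr_add)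
  qed
  also have "\<dots> = D powr (\<alpha> + \<beta> - 1) * Beta \<beta> \<alpha>"
  proof -
    have "integral {s<..<t} (\<lambda>r. \<bar>\<phi>' r / D\<bar> * f (G r)) = Beta \<beta> \<alpha>"
      using * unfolding integral_open_interval_real by blast
    thus ?thesis by (simp only: integral_mult_right)
  qed
  finally show "(LBINT r:{s<..<t}. K r) = Beta \<alpha> \<beta> * (\<phi> t - \<phi> s) powr (\<alpha> + \<beta> - 1)"
    by (simp add: D_def Beta_commute)
qed

subsection \<open>Semigroup law and power functions\<close>

lemma L1_measurable: "L1 h \<Longrightarrow> (\<lambda>s. indicator {a<..<b} s * h s) \<in> borel_measurable borel"
  using borel_measurable_integrable[of lborel "\<lambda>s. indicator {a<..<b} s * h s"] by (auto simp: set_integrable_def dest: borel_measurable_integrable)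

text \<open>Fubini's theorem on the triangle a < s < r < t: integrating over r first produces the
  Beta kernel of order \<alpha> + \<beta>, integrating over s first produces I^\<beta> h. The
  integrability that Fubini needs is existence of order \<alpha> + \<beta> at the one point t, so
  orders with \<alpha> + \<beta> < 1 are covered.\<close>

lemma I_semigroup_pos:
  assumes t: "t \<in> {a<..b}" and pos: "\<alpha> > 0" "\<beta> > 0" and h: "L1 h"
    and ex: "I_exists (\<alpha> + \<beta>) h t"
  shows "I_exists \<alpha> (I \<beta> h) t" and "I \<alpha> (I \<beta> h) t = I (\<alpha> + \<beta>) h t"
proof -
  have g: "Gamma \<alpha> \<noteq> 0" "Gamma \<beta> \<noteq> 0" "Gamma (\<alpha> + \<beta>) \<noteq> 0"
    using pos Gamma_real_nonzero by auto
  \<comment> \<open>Clamping the argument to [a, b] gives functions continuous on the whole line,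
    hence Borel, that agree with \<open>\<phi>\<close> and \<open>\<phi>'\<close> on the
    interval.\<close>
  define P where "P = (\<lambda>s. \<phi> (max a (min b s)))"
  define p where "p = (\<lambda>s. \<phi>' (max a (min b s)))"
  define hh where "hh = (\<lambda>s. indicator {a<..<b} s * h s)"
  have "continuous_on UNIV P" "continuous_on UNIV p" unfolding P_def p_def using ab
    by (auto intro!: continuous_on_compose2[OF cont] continuous_on_compose2[OF cont'] continuous_intros)
  hence [measurable]: "P \<in> borel_measurable borel" "p \<in> borel_measurable borel"
    by (auto intro: borel_measurable_continuous_onI)
  have [measurable]: "hh \<in> borel_measurable borel"
    unfolding hh_def by (rule L1_measurable[OF h])
  define F where "F = (\<lambda>(s, r). if a < s \<and> s < r \<and> r < t then
     p r * (P t - P r) powr (\<alpha> - 1) * (P r - P s) powr (\<beta> - 1) * (p s * hh s) else 0)"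
  define K where "K = (\<lambda>s r. \<phi>' r * (\<phi> t - \<phi> r) powr (\<alpha> - 1) * (\<phi> r - \<phi> s) powr (\<beta> - 1))"
  define c where "c = (\<lambda>s. indicator {a<..<t} s * (\<phi>' s * h s))"
  have P: "P s = \<phi> s" "p s = \<phi>' s" if "s \<in> {a<..<b} \<or> s = t" for s
    using that t by (auto simp: P_def p_def min_def max_def)
  have F1: "F (s, r) = (indicator {s<..<t} r *\<^sub>R K s r) * c s" for s r
    using t by (auto simp: F_def K_def c_def indicator_def P hh_def)
  have F2: "F (s, r) = (indicator {a<..<t} r * (\<phi>' r * (\<phi> t - \<phi> r) powr (\<alpha> - 1))) *
      (indicator {a<..<r} s *\<^sub>R (\<phi>' s * (\<phi> r - \<phi> s) powr (\<beta> - 1) * h s))" for s r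
    using t by (auto simp: F_def indicator_def P hh_def)
  have K_nonneg: "K s r \<ge> 0" if "s \<in> {a<..<t}" "r \<in> {s<..<t}" for s r
    using pos'[of r] that t by (auto simp: K_def)
  have Kint: "integrable lborel (\<lambda>r. indicator {s<..<t} r *\<^sub>R K s r)"
    and Kval: "(\<integral>r. indicator {s<..<t} r *\<^sub>R K s r \<partial>lborel) = Beta \<alpha> \<beta> * (\<phi> t - \<phi> s) powr (\<alpha> + \<beta> - 1)"
    if "s \<in> {a<..<t}" for s
    using beta_kernel[of s t \<alpha> \<beta>] that t pos unfolding K_def
    by (auto simp: set_integrable_def set_lebesgue_integral_def)
  have c0: "c s = 0" if "s \<notin> {a<..<t}" for s using that by (auto simp: c_def)
  have ex': "integrable lborel (\<lambda>s. indicator {a<..<t} s *\<^sub>R (\<phi>' s * (\<phi> t - \<phi> s) powr (\<alpha> + \<beta> - 1) * h s))"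
    using ex pos by (auto simp: frac_integral_exists_def set_integrable_def)
  have inner: "(\<integral>r. F (s, r) \<partial>lborel) =
      Beta \<alpha> \<beta> * (indicator {a<..<t} s *\<^sub>R (\<phi>' s * (\<phi> t - \<phi> s) powr (\<alpha> + \<beta> - 1) * h s))" for s
    using Kval[of s] by (cases "s \<in> {a<..<t}") (auto simp: F1 c_def)
  \<comment> \<open>\<open>K\<close> is nonnegative, so the r-integral of |F| is again the Beta
    kernel, now times |c(s)|; integrability of |F| thus reduces to \<open>ex'\<close>.\<close>
  have inner_norm: "(\<integral>r. norm (F (s, r)) \<partial>lborel) =
      norm (Beta \<alpha> \<beta> * (indicator {a<..<t} s *\<^sub>R (\<phi>' s * (\<phi> t - \<phi> s) powr (\<alpha> + \<beta> - 1) * h s)))" for s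
  proof (cases "s \<in> {a<..<t}")
    case True
    have "norm (F (s, r)) = (indicator {s<..<t} r *\<^sub>R K s r) * \<bar>c s\<bar>" for r
      using K_nonneg[OF True, of r] unfolding F1 by (auto simp: abs_mult indicator_def)
    moreover have "Beta \<alpha> \<beta> \<ge> 0" using pos by (simp add: Beta_def less_imp_le)
    ultimately show ?thesis using Kval[OF True] True by (simp add: c_def abs_mult)
  qed (simp add: F1 c0)
  have int: "integrable (lborel \<Otimes>\<^sub>M lborel) F"
  proof (rule lborel_pair.Fubini_integrable)
    show "F \<in> borel_measurable (lborel \<Otimes>\<^sub>M lborel)"
      unfolding F_def by measurable
    show "integrable lborel (\<lambda>s. \<integral>r. norm (F (s, r)) \<partial>lborel)"
      unfolding inner_norm by (intro integrable_norm integrable_mult_right ex')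
    show "AE s in lborel. integrable lborel (\<lambda>r. F (s, r))"
      unfolding F1 using Kint c0 by (intro AE_I2) (metis integrable_mult_left mult_zero_right integrable_zero)
  qed
  hence int': "integrable (lborel \<Otimes>\<^sub>M lborel) (case_prod (\<lambda>s r. F (s, r)))" by simp
  have outer: "(\<integral>s. F (s, r) \<partial>lborel) =
      indicator {a<..<t} r *\<^sub>R (Gamma \<beta> * (\<phi>' r * (\<phi> t - \<phi> r) powr (\<alpha> - 1) * I \<beta> h r))" for r
    unfolding F2 using pos g by (simp add: frac_integral_def set_lebesgue_integral_def)
  have "integrable lborel (\<lambda>r. \<integral>s. F (s, r) \<partial>lborel)"
    by (rule lborel_pair.integrable_snd[OF int'])
  hence "set_integrable lborel {a<..<t} (\<lambda>r. Gamma \<beta> * (\<phi>' r * (\<phi> t - \<phi> r) powr (\<alpha> - 1) * I \<beta> h r))"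
    unfolding outer by (simp add: set_integrable_def)
  hence "set_integrable lborel {a<..<t} (\<lambda>r. \<phi>' r * (\<phi> t - \<phi> r) powr (\<alpha> - 1) * I \<beta> h r)"
    using g by simp
  thus "I_exists \<alpha> (I \<beta> h) t" by (simp add: frac_integral_exists_def)
  have "(\<integral>r. \<integral>s. F (s, r) \<partial>lborel \<partial>lborel) = (\<integral>s. \<integral>r. F (s, r) \<partial>lborel \<partial>lborel)"
    by (rule lborel_pair.Fubini_integral[OF int'])
  hence "Gamma \<beta> * (LBINT r:{a<..<t}. \<phi>' r * (\<phi> t - \<phi> r) powr (\<alpha> - 1) * I \<beta> h r) =
    Beta \<alpha> \<beta> * (LBINT s:{a<..<t}. \<phi>' s * (\<phi> t - \<phi> s) powr (\<alpha> + \<beta> - 1) * h s)"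
    unfolding outer inner set_lebesgue_integral_def by (simp add: mult.left_commute[of _ "Gamma \<beta>"])
  hence "Gamma \<beta> * (Gamma \<alpha> * I \<alpha> (I \<beta> h) t) = Beta \<alpha> \<beta> * (Gamma (\<alpha> + \<beta>) * I (\<alpha> + \<beta>) h t)"
    using pos g by (simp add: frac_integral_def)
  thus "I \<alpha> (I \<beta> h) t = I (\<alpha> + \<beta>) h t"
    using g by (simp add: Beta_def)
qed

lemma I_0 [simp]: "I 0 h = h"
  by (simp add: fun_eq_iff frac_integral_def)

lemma I_exists_0 [simp]: "I_exists 0 h t"
  by (simp add: frac_integral_exists_def)

lemma I_at_a: "\<alpha> > 0 \<Longrightarrow> I \<alpha> h a = 0"
  by (simp add: frac_integral_def set_lebesgue_integral_def)

lemma I_semigroup: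
  assumes "t \<in> {a<..b}" "\<alpha> \<ge> 0" "\<beta> \<ge> 0" "L1 h" "I_exists (\<alpha> + \<beta>) h t"
  shows "I_exists \<alpha> (I \<beta> h) t" "I \<alpha> (I \<beta> h) t = I (\<alpha> + \<beta>) h t"
proof -
  have "I_exists \<alpha> (I \<beta> h) t \<and> I \<alpha> (I \<beta> h) t = I (\<alpha> + \<beta>) h t"
  proof (cases "\<alpha> = 0 \<or> \<beta> = 0")
    case False
    thus ?thesis using I_semigroup_pos[of t \<alpha> \<beta> h] assms by auto
  qed (use assms in auto)
  thus "I_exists \<alpha> (I \<beta> h) t" "I \<alpha> (I \<beta> h) t = I (\<alpha> + \<beta>) h t" by auto
qed

text \<open>This is the semigroup law with outer order 1 at b: existence of I^1 (I^\<beta> h) there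
  is integrability of I^\<beta> h.\<close>

lemma I_L1:
  assumes "L1 h" "\<beta> \<ge> 0" shows "L1 (I \<beta> h)"
  using I_semigroup(1)[of b 1 \<beta> h] L1_imp_I_exists[of h "1 + \<beta>" b] assms ab
  by (auto simp: I_exists_1_iff)

text \<open>Agreement is required at t itself as well, because the integral of order 0 is evaluation
  at t.\<close>

lemma I_cong:
  assumes "\<And>s. s \<in> {a<..t} \<Longrightarrow> h s = k s" "a < t"
  shows "I \<alpha> h t = I \<alpha> k t"
proof -
  have "(LBINT s:{a<..<t}. \<phi>' s * (\<phi> t - \<phi> s) powr (\<alpha> - 1) * h s) =
      (LBINT s:{a<..<t}. \<phi>' s * (\<phi> t - \<phi> s) powr (\<alpha> - 1) * k s)"
    by (rule set_lebesgue_integral_cong) (use assms in auto)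
  thus ?thesis using assms by (auto simp: frac_integral_def)
qed

lemma I_add:
  assumes "I_exists \<alpha> h t" "I_exists \<alpha> k t"
  shows "I_exists \<alpha> (\<lambda>s. h s + k s) t" "I \<alpha> (\<lambda>s. h s + k s) t = I \<alpha> h t + I \<alpha> k t"
  using assms by (auto simp: frac_integral_exists_def frac_integral_def distrib_left add_divide_distrib)

lemma I_cmult:
  "I_exists \<alpha> h t \<Longrightarrow> I_exists \<alpha> (\<lambda>s. c * h s) t" "I \<alpha> (\<lambda>s. c * h s) t = c * I \<alpha> h t"
  by (auto simp: frac_integral_exists_def frac_integral_def mult.left_commute[of _ c])

lemma I_power:
  assumes t: "t \<in> {a<..b}" and "\<alpha> \<ge> 0" "c > 0"
  shows "I_exists \<alpha> (\<lambda>s. (\<phi> s - \<phi> a) powr (c - 1)) t"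
    and "I \<alpha> (\<lambda>s. (\<phi> s - \<phi> a) powr (c - 1)) t = Gamma c / Gamma (c + \<alpha>) * (\<phi> t - \<phi> a) powr (c + \<alpha> - 1)"
proof -
  have g: "Gamma \<alpha> \<noteq> 0" if "\<alpha> \<noteq> 0" using Gamma_real_nonzero[of \<alpha>] that assms by simp
  have g': "Gamma c \<noteq> 0" using Gamma_real_nonzero[of c] assms by simp
  show "I_exists \<alpha> (\<lambda>s. (\<phi> s - \<phi> a) powr (c - 1)) t"
    using beta_kernel(1)[of a t \<alpha> c] assms by (cases "\<alpha> = 0") (auto simp: frac_integral_exists_def)
  show "I \<alpha> (\<lambda>s. (\<phi> s - \<phi> a) powr (c - 1)) t = Gamma c / Gamma (c + \<alpha>) * (\<phi> t - \<phi> a) powr (c + \<alpha> - 1)"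
    using beta_kernel(2)[of a t \<alpha> c] assms g g'
    by (cases "\<alpha> = 0") (auto simp: frac_integral_def Beta_def add_ac)
qed

lemma power_L1: "c > 0 \<Longrightarrow> L1 (\<lambda>s. (\<phi> s - \<phi> a) powr (c - 1))"
  using I_power(1)[of b 1 c] ab by (simp add: I_exists_1_iff)

section \<open>Majorants by powers of \<open>\<phi> t - \<phi> a\<close>, and the weighted
  space\<close>

lemma I_bound:
  assumes t: "t \<in> {a<..b}" and "\<alpha> \<ge> 0" "c > 0" "M \<ge> 0"
    and bd: "\<And>s. s \<in> {a<..t} \<Longrightarrow> \<bar>h s\<bar> \<le> M * (\<phi> s - \<phi> a) powr (c - 1)"
  shows "\<bar>I \<alpha> h t\<bar> \<le> M * Gamma c / Gamma (c + \<alpha>) * (\<phi> t - \<phi> a) powr (c + \<alpha> - 1)"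
proof (cases "\<alpha> = 0")
  case True
  thus ?thesis using bd[of t] t Gamma_real_nonzero[of c] assms by simp
next
  case False
  hence \<alpha>: "\<alpha> > 0" using assms by simp
  let ?k = "\<lambda>h s. \<phi>' s * (\<phi> t - \<phi> s) powr (\<alpha> - 1) * h s"
  let ?p = "\<lambda>s. M * (\<phi> s - \<phi> a) powr (c - 1)"
  have "I_exists \<alpha> ?p t" using I_power(1)[of t \<alpha> c] assms by (intro I_cmult)
  hence p: "set_integrable lborel {a<..<t} (?k ?p)"
    using \<alpha> by (simp add: frac_integral_exists_def)
  have "\<bar>LBINT s:{a<..<t}. ?k h s\<bar> \<le> (LBINT s:{a<..<t}. ?k ?p s)"
  proof -
    \<comment> \<open>If the integrand with h is not integrable, its integral is 0 by default and
      the chain still holds, since the majorant is integrable and nonnegative.\<close>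
    have "norm (LBINT s:{a<..<t}. ?k h s) \<le> (\<integral>s. norm (indicator {a<..<t} s *\<^sub>R ?k h s) \<partial>lborel)"
      unfolding set_lebesgue_integral_def by (rule integral_norm_bound)
    also have "\<dots> \<le> (\<integral>s. indicator {a<..<t} s *\<^sub>R ?k ?p s \<partial>lborel)"
    proof (rule integral_mono')
      show "integrable lborel (\<lambda>s. indicator {a<..<t} s *\<^sub>R ?k ?p s)"
        using p by (simp add: set_integrable_def)
      show "norm (indicator {a<..<t} s *\<^sub>R ?k h s) \<le> indicator {a<..<t} s *\<^sub>R ?k ?p s" for s
        using bd[of s] pos'[of s] t
        by (cases "s \<in> {a<..<t}") (auto simp: abs_mult abs_of_pos intro!: mult_left_mono)
      show "0 \<le> indicator {a<..<t} s *\<^sub>R ?k ?p s" for s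
        using pos'[of s] t \<open>M \<ge> 0\<close> by (auto simp: indicator_def)
    qed
    finally show ?thesis by (simp add: set_lebesgue_integral_def)
  qed
  hence "\<bar>I \<alpha> h t\<bar> \<le> I \<alpha> ?p t"
    using \<alpha> Gamma_real_pos[OF \<alpha>] by (simp add: frac_integral_def abs_mult divide_right_mono)
  also have "\<dots> = M * Gamma c / Gamma (c + \<alpha>) * (\<phi> t - \<phi> a) powr (c + \<alpha> - 1)"
    using I_power(2)[of t \<alpha> c] assms by (simp add: I_cmult)
  finally show ?thesis .
qed

text \<open>On (a, b] the function is X^(-\<gamma>) u with u continuous on the compact interval
  [a, b], hence bounded; X^(-\<gamma>) is continuous away from a.\<close>

lemma weighted_spaceE:
  assumes "h \<in> weighted_space \<phi> a b \<gamma>"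
  obtains M where "M \<ge> 0" "\<And>s. s \<in> {a<..b} \<Longrightarrow> \<bar>h s\<bar> \<le> M * (\<phi> s - \<phi> a) powr (- \<gamma>)"
    and "continuous_on {a<..b} h"
proof -
  obtain u where u: "continuous_on {a..b} u" "\<And>t. t \<in> {a<..b} \<Longrightarrow> u t = (\<phi> t - \<phi> a) powr \<gamma> * h t"
    using assms by (auto simp: weighted_space_def)
  have hu: "h t = (\<phi> t - \<phi> a) powr (- \<gamma>) * u t" if "t \<in> {a<..b}" for t
    using u(2)[OF that] phi_less[of a t] that by (simp add: powr_minus)
  have "continuous_on {a<..b} (\<lambda>t. (\<phi> t - \<phi> a) powr (- \<gamma>) * u t)"
    using ab by (intro continuous_on_mult X_continuous continuous_on_subset[OF u(1)]) auto
  hence c: "continuous_on {a<..b} h" by (subst continuous_on_cong[OF refl hu])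
  have "compact (u ` {a..b})" using u(1) by (intro compact_continuous_image) auto
  then obtain M where "\<And>t. t \<in> {a..b} \<Longrightarrow> norm (u t) \<le> M"
    by (meson bounded_iff compact_imp_bounded image_eqI)
  hence "\<bar>h s\<bar> \<le> max M 0 * (\<phi> s - \<phi> a) powr (- \<gamma>)" if "s \<in> {a<..b}" for s
  proof -
    have "\<bar>u s\<bar> \<le> max M 0" using \<open>\<And>t. t \<in> {a..b} \<Longrightarrow> norm (u t) \<le> M\<close>[of s] that by auto
    from mult_right_mono[OF this, of "(\<phi> s - \<phi> a) powr (- \<gamma>)"] show ?thesis
      unfolding hu[OF that] by (simp add: abs_mult mult.commute)
  qed
  thus ?thesis using that[of "max M 0"] c by auto
qed

text \<open>Since \<gamma> < 1, the bound X^(-\<gamma>) is X^(c - 1) with c = 1 - \<gamma> > 0, and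
  \<open>I_power\<close> makes it an integrable majorant.\<close>

lemma weighted_I_exists:
  assumes h: "h \<in> weighted_space \<phi> a b \<gamma>" and "\<gamma> < 1" "\<alpha> \<ge> 0" "t \<in> {a<..b}"
  shows "I_exists \<alpha> h t"
proof (cases "\<alpha> = 0")
  case False
  obtain M where M: "M \<ge> 0" "\<And>s. s \<in> {a<..b} \<Longrightarrow> \<bar>h s\<bar> \<le> M * (\<phi> s - \<phi> a) powr (- \<gamma>)"
    and c: "continuous_on {a<..b} h" using weighted_spaceE[OF h] by blast
  let ?k = "\<lambda>h s. \<phi>' s * (\<phi> t - \<phi> s) powr (\<alpha> - 1) * h s"
  let ?p = "\<lambda>s. M * (\<phi> s - \<phi> a) powr ((1 - \<gamma>) - 1)"
  have "I_exists \<alpha> ?p t" using I_power(1)[of t \<alpha> "1 - \<gamma>"] assms by (intro I_cmult) auto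
  hence "set_integrable lborel {a<..<t} (?k ?p)"
    using False by (simp add: frac_integral_exists_def)
  moreover have "set_borel_measurable lborel {a<..<t} (?k h)"
  proof -
    have "continuous_on {a<..<t} (?k h)"
      using assms by (intro continuous_intros kernel_continuous cont_subset continuous_on_subset[OF c]) auto
    thus ?thesis
      unfolding set_borel_measurable_def by (simp add: borel_measurable_continuous_on_indicator del: real_scaleR_def)
  qed
  moreover have "norm (?k h s) \<le> norm (?k ?p s)" if "s \<in> {a<..<t}" for s
    using M(2)[of s] M(1) that assms by (auto simp: abs_mult abs_of_pos intro!: mult_left_mono)
  ultimately have "set_integrable lborel {a<..<t} (?k h)"
    by (blast intro: set_integrable_bound AE_I2)
  thus ?thesis by (simp add: frac_integral_exists_def)
qed auto

lemma weighted_L1: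
  assumes "h \<in> weighted_space \<phi> a b \<gamma>" and "\<gamma> < 1" shows "L1 h"
  using weighted_I_exists[OF assms, of 1 b] ab by (simp add: I_exists_1_iff)

subsection \<open>Integration and differentiation\<close>

lemma I1_integral:
  assumes "L1 h"
  shows "(\<lambda>s. \<phi>' s * h s) integrable_on {a..b}"
    and "t \<in> {a..b} \<Longrightarrow> I 1 h t = integral {a..t} (\<lambda>s. \<phi>' s * h s)"
proof -
  have *: "L1 (\<lambda>s. \<phi>' s * h s)" using assms by (simp add: L1_phi'_iff)
  thus "(\<lambda>s. \<phi>' s * h s) integrable_on {a..b}"
    by (metis integrable_on_open_interval_real set_borel_integral_eq_integral(1))
  assume t: "t \<in> {a..b}"
  have **: "set_integrable lborel {a<..<t} (\<lambda>s. \<phi>' s * h s)"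
    by (rule set_integrable_subset[OF *]) (use t in auto)
  have "I 1 h t = (LBINT s:{a<..<t}. \<phi>' s * (\<phi> t - \<phi> s) powr (1 - 1) * h s)"
    by (simp add: frac_integral_def)
  also have "\<dots> = (LBINT s:{a<..<t}. \<phi>' s * h s)"
    by (rule set_lebesgue_integral_cong) (use phi_neq[of _ t] t in auto)
  also have "\<dots> = integral {a..t} (\<lambda>s. \<phi>' s * h s)"
    by (simp add: set_borel_integral_eq_integral[OF **] integral_open_interval_real)
  finally show "I 1 h t = integral {a..t} (\<lambda>s. \<phi>' s * h s)" .
qed

lemma I1_continuous:
  assumes "L1 h" shows "continuous_on {a..b} (I 1 h)"
  using indefinite_integral_continuous_1[OF I1_integral(1)[OF assms]]
  by (subst continuous_on_cong[OF refl I1_integral(2)[OF assms]]) auto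

lemma I1_tendsto_0:
  assumes "L1 h" shows "(I 1 h \<longlongrightarrow> 0) (at_right a)"
proof -
  have "(I 1 h \<longlongrightarrow> I 1 h a) (at a within {a..b})"
    using I1_continuous[OF assms] ab by (auto simp: continuous_on_def)
  thus ?thesis using ab by (simp add: I_at_a at_within_Icc_at_right)
qed

lemma I1_deriv:
  assumes "L1 h" "continuous_on {a<..b} h" "t \<in> {a<..b}"
  shows "(I 1 h has_vector_derivative \<phi>' t * h t) (at t within {a<..b})"
proof -
  \<comment> \<open>The point a is the exceptional point of the fundamental theorem: h is continuous
    on (a, b] only and may be unbounded at a.\<close>
  have eq: "{a..b} - {a} = {a<..b}" by auto
  have "continuous_on {a<..b} (\<lambda>s. \<phi>' s * h s)"
    using assms by (intro continuous_intros cont_subset) auto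
  hence "((\<lambda>u. integral {a..u} (\<lambda>s. \<phi>' s * h s)) has_vector_derivative \<phi>' t * h t) (at t within {a..b} - {a})"
    using assms unfolding eq[symmetric]
    by (intro integral_has_vector_derivative_continuous_at I1_integral) (auto simp: continuous_on_eq_continuous_within)
  thus ?thesis
    unfolding eq by (rule has_vector_derivative_transform[rotated 2]) (use assms I1_integral(2)[OF assms(1)] in auto)
qed

lemma at_within_nontrivial: "t \<in> {a<..b} \<Longrightarrow> at t within {a<..b} \<noteq> bot"
  using islimpt_Ioc[of a b t] ab by (simp add: trivial_limit_within)

text \<open>Differentiate both sides and divide by \<open>\<phi>'\<close>; continuity of both
  functions is what gives equality at every point.\<close>

lemma I1_cancel:
  assumes "L1 h" "L1 k" "continuous_on {a<..b} h" "continuous_on {a<..b} k"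
    and eq: "\<And>t. t \<in> {a<..b} \<Longrightarrow> I 1 h t = I 1 k t" and t: "t \<in> {a<..b}"
  shows "h t = k t"
proof -
  have "(I 1 h has_vector_derivative \<phi>' t * k t) (at t within {a<..b})"
    by (rule has_vector_derivative_transform[OF t _ I1_deriv[of k t]]) (use assms in auto)
  with I1_deriv[of h t] assms have "\<phi>' t * h t = \<phi>' t * k t"
    by (meson at_within_nontrivial vector_derivative_unique_within)
  thus ?thesis using pos'[of t] t by simp
qed

lemma I_continuous:
  assumes "L1 h" "\<alpha> \<ge> 1" shows "continuous_on {a<..b} (I \<alpha> h)"
proof -
  have eq: "I \<alpha> h t = I 1 (I (\<alpha> - 1) h) t" if "t \<in> {a<..b}" for t
    using I_semigroup(2)[of t 1 "\<alpha> - 1" h] L1_imp_I_exists[of h \<alpha> t] assms that by simp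
  show ?thesis
    by (subst continuous_on_cong[OF refl eq])
      (use assms in \<open>auto intro!: continuous_on_subset[OF I1_continuous[OF I_L1]]\<close>)
qed

text \<open>The fundamental theorem of calculus is applied on [t, b], which stays away from a; hence
  the constant is read off at b.\<close>

lemma antiderivative_eq:
  assumes "\<And>t. t \<in> {a<..b} \<Longrightarrow> (F has_vector_derivative \<phi>' t * k t) (at t within {a<..b})" "L1 k"
  obtains c where "\<And>t. t \<in> {a<..b} \<Longrightarrow> F t = c + I 1 k t"
proof (rule that[of "F b - I 1 k b"])
  fix t assume t: "t \<in> {a<..b}"
  have "((\<lambda>s. \<phi>' s * k s) has_integral (F b - F t)) {t..b}"
    using t by (intro fundamental_theorem_of_calculus has_vector_derivative_within_subset[OF assms(1)]) auto
  moreover have "integral {a..t} (\<lambda>s. \<phi>' s * k s) + integral {t..b} (\<lambda>s. \<phi>' s * k s) = integral {a..b} (\<lambda>s. \<phi>' s * k s)"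
    using t I1_integral[OF assms(2)] by (intro Henstock_Kurzweil_Integration.integral_combine) auto
  ultimately show "F t = F b - I 1 k b + I 1 k t"
    using t ab by (simp add: I1_integral(2)[OF assms(2)] integral_unique)
qed

lemma phi_deriv_exists_2D:
  assumes "phi_deriv_exists \<phi>' a b 2 w" "t \<in> {a<..b}"
  shows "(w has_vector_derivative \<phi>' t * phi_deriv \<phi>' a b 1 w t) (at t within {a<..b})"
    and "(phi_deriv \<phi>' a b 1 w has_vector_derivative \<phi>' t * phi_deriv \<phi>' a b 2 w t) (at t within {a<..b})"
proof -
  have "phi_deriv \<phi>' a b k w differentiable (at t within {a<..b})" if "k < 2" for k
    using assms that by (auto simp: phi_deriv_exists_def)
  from this[of 0] this[of 1] show "(w has_vector_derivative \<phi>' t * phi_deriv \<phi>' a b 1 w t) (at t within {a<..b})"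
    and "(phi_deriv \<phi>' a b 1 w has_vector_derivative \<phi>' t * phi_deriv \<phi>' a b 2 w t) (at t within {a<..b})"
    using pos'[of t] assms by (auto simp: vector_derivative_works numeral_2_eq_2)
qed

lemma phi_deriv_2_representation:
  assumes ex: "phi_deriv_exists \<phi>' a b 2 w" and L1: "L1 (phi_deriv \<phi>' a b 2 w)"
  obtains c0 c1 where "\<And>t. t \<in> {a<..b} \<Longrightarrow> w t = c0 + c1 * (\<phi> t - \<phi> a) + I 2 (phi_deriv \<phi>' a b 2 w) t"
proof -
  let ?p = "phi_deriv \<phi>' a b 1 w" and ?v = "phi_deriv \<phi>' a b 2 w"
  \<comment> \<open>The constant 1 is written as X^(1 - 1) so that \<open>I_power\<close> and
    \<open>power_L1\<close> apply; the two agree on (a, b].\<close>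
  let ?one = "\<lambda>s. (\<phi> s - \<phi> a) powr (1 - 1)"
  obtain c1 where c1: "\<And>t. t \<in> {a<..b} \<Longrightarrow> ?p t = c1 + I 1 ?v t"
    using antiderivative_eq[OF phi_deriv_exists_2D(2)[OF ex] L1] by blast
  have p: "?p t = c1 * ?one t + I 1 ?v t" if "t \<in> {a<..b}" for t
    using c1[OF that] phi_less[of a t] that by simp
  have "L1 (\<lambda>t. c1 * ?one t + I 1 ?v t)"
    using power_L1[of 1] I_L1[OF L1, of 1] by (intro set_integral_add set_integrable_mult_right) auto
  also have "?this \<longleftrightarrow> L1 ?p" by (rule set_integrable_cong) (use p in auto)
  finally obtain c0 where c0: "\<And>t. t \<in> {a<..b} \<Longrightarrow> w t = c0 + I 1 ?p t"
    using antiderivative_eq[OF phi_deriv_exists_2D(1)[OF ex]] by blast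
  have "w t = c0 + c1 * (\<phi> t - \<phi> a) + I 2 ?v t" if t: "t \<in> {a<..b}" for t
  proof -
    have "I 1 ?p t = I 1 (\<lambda>t. c1 * ?one t + I 1 ?v t) t"
      by (rule I_cong) (use p t in auto)
    also have "\<dots> = c1 * I 1 ?one t + I 1 (I 1 ?v) t"
      using I_power(1)[of t 1 1] L1_imp_I_exists[OF I_L1[OF L1]] t by (subst I_add(2)) (auto intro: I_cmult simp: I_cmult)
    also have "I 1 (I 1 ?v) t = I 2 ?v t"
      using I_semigroup(2)[of t 1 1 ?v] L1_imp_I_exists[OF L1, of 2 t] t L1 by simp
    also have "I 1 ?one t = \<phi> t - \<phi> a"
      using I_power(2)[of t 1 1] phi_less[of a t] t by (simp add: Gamma_numeral)
    finally show ?thesis using c0[OF t] by simp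
  qed
  thus ?thesis using that by blast
qed

section \<open>Behaviour at the left endpoint\<close>

lemma X_tendsto_0: "((\<lambda>t. \<phi> t - \<phi> a) \<longlongrightarrow> 0) (at_right a)"
proof -
  have "(\<phi> \<longlongrightarrow> \<phi> a) (at a within {a..b})" using cont ab by (auto simp: continuous_on_def)
  thus ?thesis using ab by (simp add: at_within_Icc_at_right LIM_zero)
qed

lemma eventually_at_right_a: "eventually (\<lambda>t. t \<in> {a<..b}) (at_right a)"
  using eventually_at_right_less eventually_at_right_field ab
  by (auto simp: eventually_at_right_field intro!: exI[of _ b])

lemma X_powr_tendsto_0:
  assumes "c > 0" shows "((\<lambda>t. (\<phi> t - \<phi> a) powr c) \<longlongrightarrow> 0) (at_right a)"
proof -
  have "eventually (\<lambda>t. 0 \<le> \<phi> t - \<phi> a) (at_right a)"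
    using eventually_at_right_a by eventually_elim (use phi_less in force)
  with tendsto_powr'[OF X_tendsto_0 tendsto_const[of c]] assms show ?thesis by simp
qed

text \<open>Where |h| < M near a, \<open>I_bound\<close> with c = 1 gives |I^\<gamma> h| \<le> M /
  Gamma(1 + \<gamma>) X^\<gamma>, and M can be taken arbitrarily small.\<close>

lemma I_quotient_tendsto_0:
  assumes "(h \<longlongrightarrow> 0) (at_right a)" "\<gamma> \<ge> 0"
  shows "((\<lambda>t. I \<gamma> h t / (\<phi> t - \<phi> a) powr \<gamma>) \<longlongrightarrow> 0) (at_right a)"
proof (rule tendstoI)
  fix e :: real assume e: "e > 0"
  have G: "Gamma (1 + \<gamma>) > 0" using assms by (intro Gamma_real_pos) auto
  \<comment> \<open>Chosen so that the bound becomes (e / 2) X^\<gamma>; the factor 1/2 yields the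
    strict inequality.\<close>
  define M where "M = e / 2 * Gamma (1 + \<gamma>)"
  have M: "M > 0" using e G by (simp add: M_def)
  have "eventually (\<lambda>t. \<bar>h t\<bar> < M) (at_right a)"
    using tendstoD[OF assms(1) M] by simp
  then obtain d where d: "d > a" "\<And>t. a < t \<Longrightarrow> t < d \<Longrightarrow> \<bar>h t\<bar> < M"
    by (auto simp: eventually_at_right_field)
  have ev: "eventually (\<lambda>t. t < d) (at_right a)" using d by (auto simp: eventually_at_right_field)
  show "eventually (\<lambda>t. dist (I \<gamma> h t / (\<phi> t - \<phi> a) powr \<gamma>) 0 < e) (at_right a)"
    using ev eventually_at_right_a
  proof eventually_elim
    case (elim t)
    have X: "(\<phi> t - \<phi> a) powr \<gamma> > 0" using phi_less[of a t] elim by simp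
    have "\<bar>h s\<bar> \<le> M * (\<phi> s - \<phi> a) powr (1 - 1)" if "s \<in> {a<..t}" for s
      using d(2)[of s] phi_less[of a s] elim that by auto
    from I_bound[of t \<gamma> 1 M h, OF _ _ _ _ this]
    have "\<bar>I \<gamma> h t\<bar> \<le> e / 2 * (\<phi> t - \<phi> a) powr \<gamma>" using elim assms M G by (simp add: M_def)
    also have "\<dots> < e * (\<phi> t - \<phi> a) powr \<gamma>" using e X by simp
    finally show ?case using X by (simp add: field_simps)
  qed
qed

lemma I_tendsto_0:
  assumes "(h \<longlongrightarrow> 0) (at_right a)" "\<gamma> \<ge> 0"
  shows "(I \<gamma> h \<longlongrightarrow> 0) (at_right a)"
proof (cases "\<gamma> = 0")
  case False
  have "((\<lambda>t. I \<gamma> h t / (\<phi> t - \<phi> a) powr \<gamma> * (\<phi> t - \<phi> a) powr \<gamma>) \<longlongrightarrow> 0 * 0) (at_right a)"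
    using False assms by (intro tendsto_mult I_quotient_tendsto_0 X_powr_tendsto_0) auto
  moreover have "eventually (\<lambda>t. I \<gamma> h t / (\<phi> t - \<phi> a) powr \<gamma> * (\<phi> t - \<phi> a) powr \<gamma> = I \<gamma> h t) (at_right a)"
    using eventually_at_right_a by eventually_elim (use phi_less in force)
  ultimately show ?thesis by (auto intro: Lim_transform_eventually)
qed (use assms in auto)

section \<open>Representation of y through v, and pointwise values of I^\<beta> v\<close>

lemma hilfer_representation:
  assumes \<xi>: "1 < \<xi>" "\<xi> \<le> 2" and y: "y \<in> weighted_space \<phi> a b (2 - \<xi>)" "(y \<longlongrightarrow> 0) (at_right a)"
    and ex: "phi_deriv_exists \<phi>' a b 2 (I (2 - \<xi>) y)"
  defines "v \<equiv> phi_deriv \<phi>' a b 2 (I (2 - \<xi>) y)"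
  assumes v: "L1 v"
  obtains C where "\<And>t. t \<in> {a<..b} \<Longrightarrow> y t = C * (\<phi> t - \<phi> a) powr (\<xi> - 1) + I \<xi> v t"
proof -
  define w where "w = I (2 - \<xi>) y"
  obtain c0 c1 where w: "\<And>t. t \<in> {a<..b} \<Longrightarrow> w t = c0 + c1 * (\<phi> t - \<phi> a) + I 2 v t"
    using phi_deriv_2_representation[OF ex] v unfolding v_def w_def by blast
  have y1: "L1 y" using weighted_L1[OF y(1)] \<xi> by simp
  have I2v: "I 1 (I 1 v) t = I 2 v t" if "t \<in> {a<..b}" for t
    using I_semigroup(2)[of t 1 1 v] L1_imp_I_exists[OF v, of 2 t] that v by simp
  \<comment> \<open>Both summands after \<open>c0\<close> tend to 0, so \<open>c0\<close> is the
    limit of \<open>w\<close> at a. That limit is 0 because y tends to 0 and the order 2 - \<xi> is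
    nonnegative.\<close>
  have "((\<lambda>t. c0 + c1 * (\<phi> t - \<phi> a) + I 1 (I 1 v) t) \<longlongrightarrow> c0 + c1 * 0 + 0) (at_right a)"
    by (intro tendsto_intros X_tendsto_0 I1_tendsto_0 I_L1 v) auto
  moreover have "eventually (\<lambda>t. c0 + c1 * (\<phi> t - \<phi> a) + I 1 (I 1 v) t = w t) (at_right a)"
    using eventually_at_right_a by eventually_elim (simp add: w I2v)
  ultimately have "(w \<longlongrightarrow> c0) (at_right a)"
    using Lim_transform_eventually by fastforce
  moreover have "(w \<longlongrightarrow> 0) (at_right a)"
    unfolding w_def using \<xi> by (intro I_tendsto_0 y) auto
  ultimately have c0: "c0 = 0"
    using tendsto_unique trivial_limit_at_right_real by blast
  \<comment> \<open>Both I^(\<xi> - 1) X and I^1 X^(\<xi> - 1) are multiples of X^\<xi>; comparing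
    their Gamma factors gives this constant.\<close>
  define C where "C = c1 / Gamma \<xi>"
  define z where "z = (\<lambda>t. C * (\<phi> t - \<phi> a) powr (\<xi> - 1) + I \<xi> v t)"
  have z1: "L1 z" unfolding z_def
    using \<xi> by (intro set_integral_add set_integrable_mult_right power_L1 I_L1 v) auto
  \<comment> \<open>Applying I^(\<xi> - 1) to \<open>w\<close> raises the order of integration of y
    from 2 - \<xi> to 1. Both y and \<open>z\<close> are continuous on (a, b], so this I^1 can be
    cancelled.\<close>
  have "y t = z t" if "t \<in> {a<..b}" for t
  proof (rule I1_cancel[OF y1 z1 _ _ _ that])
    show "continuous_on {a<..b} y" using weighted_spaceE[OF y(1)] by blast
    show "continuous_on {a<..b} z"
      unfolding z_def using \<xi> ab by (intro continuous_intros X_continuous I_continuous v) auto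
    fix t assume t: "t \<in> {a<..b}"
    have ex: "I_exists \<alpha> v t" if "\<alpha> \<ge> 1" for \<alpha> using L1_imp_I_exists[OF v that, of t] t by simp
    have "I 1 y t = I (\<xi> - 1) w t"
      unfolding w_def using I_semigroup(2)[of t "\<xi> - 1" "2 - \<xi>" y] L1_imp_I_exists[OF y1, of 1 t] t y1 \<xi> by simp
    also have "\<dots> = I (\<xi> - 1) (\<lambda>t. c1 * (\<phi> t - \<phi> a) powr (2 - 1) + I 2 v t) t"
    proof (rule I_cong)
      fix s assume "s \<in> {a<..t}"
      thus "w s = c1 * (\<phi> s - \<phi> a) powr (2 - 1) + I 2 v s"
        using w[of s] c0 phi_less[of a s] t by simp
    qed (use t in auto)
    also have "\<dots> = c1 * I (\<xi> - 1) (\<lambda>t. (\<phi> t - \<phi> a) powr (2 - 1)) t + I (\<xi> - 1) (I 2 v) t"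
      using I_power(1)[of t "\<xi> - 1" 2] I_semigroup(1)[of t "\<xi> - 1" 2 v] ex[of "1 + \<xi>"] v t \<xi>
      by (subst I_add(2)) (auto intro!: I_cmult(1) simp: I_cmult(2))
    also have "I (\<xi> - 1) (I 2 v) t = I 1 (I \<xi> v) t"
      using I_semigroup(2)[of t "\<xi> - 1" 2 v] I_semigroup(2)[of t 1 \<xi> v] ex[of "\<xi> + 1"] v t \<xi>
      by (simp add: add.commute)
    also have "c1 * I (\<xi> - 1) (\<lambda>t. (\<phi> t - \<phi> a) powr (2 - 1)) t = C * I 1 (\<lambda>t. (\<phi> t - \<phi> a) powr (\<xi> - 1)) t"
      using I_power(2)[of t "\<xi> - 1" 2] I_power(2)[of t 1 \<xi>] t \<xi> Gamma_real_nonzero[of \<xi>]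
      by (simp add: C_def add.commute Gamma_numeral)
    also have "C * I 1 (\<lambda>t. (\<phi> t - \<phi> a) powr (\<xi> - 1)) t + I 1 (I \<xi> v) t = I 1 z t"
      unfolding z_def using I_power(1)[of t 1 \<xi>] I_semigroup(1)[of t 1 \<xi> v] ex[of "\<xi> + 1"] v t \<xi>
      by (subst I_add(2)) (auto intro!: I_cmult(1) simp: I_cmult(2) add.commute)
    finally show "I 1 y t = I 1 z t" .
  qed
  thus ?thesis using that[of C] by (simp add: z_def)
qed

text \<open>
  In terms of \<open>A = \<phi>(t) - \<phi>(r)\<close> and \<open>h = \<phi>(t) - \<phi>(s)\<close> the kernel of the difference quotient is
  \<open>(A\<^bsup>\<beta>\<^esup> - (A - h)\<^sub>+\<^bsup>\<beta>\<^esup>) / h\<close>, which is dominated by \<open>A\<^bsup>\<beta>-1\<^esup>\<close> uniformly in \<open>h\<close>.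
\<close>

lemma I_left_derivative:
  assumes v: "L1 v" and \<beta>: "0 < \<beta>" "\<beta> < 1" and t: "t \<in> {a<..b}" and ex: "I_exists \<beta> v t"
    and s: "\<And>n. s n \<in> {a<..<t}" "s \<longlonglongrightarrow> t"
  shows "(\<lambda>n. (I (1 + \<beta>) v t - I (1 + \<beta>) v (s n)) / (\<phi> t - \<phi> (s n))) \<longlonglongrightarrow> I \<beta> v t"
proof -
  define h where "h = (\<lambda>n. \<phi> t - \<phi> (s n))"
  define A where "A = (\<lambda>r. \<phi> t - \<phi> r)"
  define Q where "Q = (\<lambda>n r. (A r powr \<beta> - (if h n < A r then (A r - h n) powr \<beta> else 0)) / h n)"
  define V where "V = (\<lambda>r. indicator {a<..<t} r * (\<phi>' r * v r))"
  have sb: "s n \<in> {a..b}" for n using s(1)[of n] t by auto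
  have h: "h n > 0" for n unfolding h_def using phi_less[of "s n" t] s(1)[of n] t by auto
  have A: "A r > 0" if "r \<in> {a<..<t}" for r unfolding A_def using phi_less[of r t] that t by auto
  \<comment> \<open>The cut-off \<open>h n < A r\<close> encodes r < s(n), so that the integral up
    to s(n) becomes one over the fixed interval (a, t).\<close>
  have hA: "h n < A r \<longleftrightarrow> r < s n" if "r \<in> {a<..<t}" for n r
    unfolding A_def h_def using phi_less[of r "s n"] phi_le[of "s n" r] s(1)[of n] that t
    by (cases "r < s n") auto
  have "(\<lambda>n. \<phi> (s n)) \<longlonglongrightarrow> \<phi> t"
    by (rule continuous_on_tendsto_compose[OF cont s(2)]) (use sb t in auto)
  hence h0: "h \<longlonglongrightarrow> 0" unfolding h_def by (auto intro!: tendsto_eq_intros)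
  have k: "integrable lborel (\<lambda>r. V r * A r powr (\<beta> - 1))"
    using ex \<beta> unfolding V_def A_def frac_integral_exists_def set_integrable_def by (simp add: mult_ac)
  have ex1: "I_exists (1 + \<beta>) v x" if "x \<in> {a..b}" for x
    using L1_imp_I_exists[OF v] \<beta> that by simp
  have i1: "integrable lborel (\<lambda>r. V r * A r powr \<beta>)"
    using ex1[of t] t \<beta> unfolding V_def A_def frac_integral_exists_def set_integrable_def by (simp add: mult_ac)
  have eq2: "indicator {a<..<s n} r *\<^sub>R (\<phi>' r * (\<phi> (s n) - \<phi> r) powr (1 + \<beta> - 1) * v r) =
      V r * (if h n < A r then (A r - h n) powr \<beta> else 0)" for n r
    using hA[of r n] s(1)[of n] by (auto simp: V_def indicator_def A_def h_def)
  have "integrable lborel (\<lambda>r. indicator {a<..<s n} r *\<^sub>R (\<phi>' r * (\<phi> (s n) - \<phi> r) powr (1 + \<beta> - 1) * v r))" for n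
    using ex1[of "s n"] s(1)[of n] t \<beta> unfolding frac_integral_exists_def set_integrable_def by auto
  hence i2: "integrable lborel (\<lambda>r. V r * (if h n < A r then (A r - h n) powr \<beta> else 0))" for n
    unfolding eq2 .
  have It: "I (1 + \<beta>) v t = 1 / Gamma (1 + \<beta>) * (\<integral>r. V r * A r powr \<beta> \<partial>lborel)"
    using \<beta> by (simp add: frac_integral_def set_lebesgue_integral_def V_def A_def mult_ac)
  have Is: "I (1 + \<beta>) v (s n) = 1 / Gamma (1 + \<beta>) * (\<integral>r. V r * (if h n < A r then (A r - h n) powr \<beta> else 0) \<partial>lborel)" for n
    unfolding eq2[symmetric] using \<beta> by (simp add: frac_integral_def set_lebesgue_integral_def)
  have VQ: "V r * Q n r = (V r * A r powr \<beta> - V r * (if h n < A r then (A r - h n) powr \<beta> else 0)) / h n" for n r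
    by (simp add: Q_def right_diff_distrib)
  have quot: "(I (1 + \<beta>) v t - I (1 + \<beta>) v (s n)) / h n = 1 / Gamma (1 + \<beta>) * (\<integral>r. V r * Q n r \<partial>lborel)" for n
    unfolding VQ It Is using i1 i2[of n] by (simp add: diff_divide_distrib mult.commute)
  \<comment> \<open>The majorant |V| A^(\<beta> - 1) is integrable because I^\<beta> v exists at
    t.\<close>
  have "(\<lambda>n. \<integral>r. V r * Q n r \<partial>lborel) \<longlonglongrightarrow> (\<integral>r. \<beta> * (V r * A r powr (\<beta> - 1)) \<partial>lborel)"
  proof (rule integral_dominated_convergence[where w = "\<lambda>r. norm (V r * A r powr (\<beta> - 1))"])
    show "(\<lambda>r. \<beta> * (V r * A r powr (\<beta> - 1))) \<in> borel_measurable lborel"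
      using k by (intro borel_measurable_times borel_measurable_const borel_measurable_integrable)
    show "(\<lambda>r. V r * Q n r) \<in> borel_measurable lborel" for n
      unfolding VQ using i1 i2[of n] by (intro borel_measurable_integrable) auto
    show "integrable lborel (\<lambda>r. norm (V r * A r powr (\<beta> - 1)))"
      using k by (rule integrable_norm)
    show "AE r in lborel. norm (V r * Q n r) \<le> norm (V r * A r powr (\<beta> - 1))" for n
    proof (rule AE_I2)
      fix r
      show "norm (V r * Q n r) \<le> norm (V r * A r powr (\<beta> - 1))"
      proof (cases "r \<in> {a<..<t}")
        case True
        have "\<bar>Q n r\<bar> \<le> A r powr (\<beta> - 1)"
          unfolding Q_def using A[OF True] h[of n] \<beta> by (intro powr_quotient) auto
        thus ?thesis by (simp add: abs_mult mult_left_mono)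
      qed (simp add: V_def)
    qed
    show "AE r in lborel. (\<lambda>n. V r * Q n r) \<longlonglongrightarrow> \<beta> * (V r * A r powr (\<beta> - 1))"
    proof (rule AE_I2)
      fix r
      show "(\<lambda>n. V r * Q n r) \<longlonglongrightarrow> \<beta> * (V r * A r powr (\<beta> - 1))"
      proof (cases "r \<in> {a<..<t}")
        case True
        \<comment> \<open>The pointwise limit is the derivative of x^\<beta> at \<open>A r\<close>,
          approached along -h(n). As h(n) tends to 0, eventually h(n) < A(r) and the truncation in
          \<open>Q\<close> is inactive.\<close>
        have "((\<lambda>x. x powr \<beta>) has_real_derivative \<beta> * A r powr (\<beta> - 1)) (at (A r))"
          using A[OF True] by (rule has_real_derivative_powr)
        hence "((\<lambda>d. ((A r + d) powr \<beta> - A r powr \<beta>) / d) \<longlongrightarrow> \<beta> * A r powr (\<beta> - 1)) (at 0)"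
          by (simp add: DERIV_def)
        moreover have "filterlim (\<lambda>n. - h n) (at 0) sequentially"
          using tendsto_minus[OF h0] h by (auto simp: filterlim_at intro!: always_eventually less_imp_neq[symmetric])
        ultimately have "(\<lambda>n. ((A r + - h n) powr \<beta> - A r powr \<beta>) / - h n) \<longlonglongrightarrow> \<beta> * A r powr (\<beta> - 1)"
          by (rule filterlim_compose)
        moreover have "eventually (\<lambda>n. ((A r + - h n) powr \<beta> - A r powr \<beta>) / - h n = Q n r) sequentially"
          using order_tendstoD(2)[OF h0 A[OF True]]
          by eventually_elim (simp add: Q_def minus_divide_left)
        ultimately have "(\<lambda>n. Q n r) \<longlonglongrightarrow> \<beta> * A r powr (\<beta> - 1)"
          by (rule Lim_transform_eventually)
        from tendsto_mult_left[OF this, of "V r"] show ?thesis by (simp add: mult_ac)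
      qed (simp add: V_def)
    qed
  qed
  note lim = this
  \<comment> \<open>The factor \<beta> from differentiating the power is absorbed here, leaving the
    normalisation 1 / Gamma(\<beta>) of I^\<beta>.\<close>
  have G: "Gamma (1 + \<beta>) = \<beta> * Gamma \<beta>"
    using \<beta> Gamma_plus1[of \<beta>] nonpos_Ints_nonpos[of \<beta>] by (force simp: add.commute)
  from tendsto_mult_left[OF lim, of "1 / Gamma (1 + \<beta>)"]
  have "(\<lambda>n. (I (1 + \<beta>) v t - I (1 + \<beta>) v (s n)) / h n) \<longlonglongrightarrow>
      1 / Gamma (1 + \<beta>) * (\<beta> * (\<integral>r. V r * A r powr (\<beta> - 1) \<partial>lborel))"
    unfolding quot by simp
  also have "1 / Gamma (1 + \<beta>) * (\<beta> * (\<integral>r. V r * A r powr (\<beta> - 1) \<partial>lborel)) = I \<beta> v t"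
    using \<beta> G Gamma_real_nonzero[of \<beta>]
    by (simp add: frac_integral_def set_lebesgue_integral_def V_def A_def mult_ac add.commute)
  finally show ?thesis by (simp add: h_def)
qed

lemma I_pointwise_eq:
  assumes v: "L1 v" and g: "L1 g" "continuous_on {a<..b} g"
    and \<beta>: "0 < \<beta>" "\<beta> < 1" and t: "t \<in> {a<..b}" and ex: "I_exists \<beta> v t"
    and eq: "\<And>s. s \<in> {a<..b} \<Longrightarrow> I 1 g s = I (1 + \<beta>) v s"
  shows "I \<beta> v t = g t"
proof -
  \<comment> \<open>The shift n + 2 keeps s(0) strictly above a; n + 1 would give s(0) = a.\<close>
  define s where "s = (\<lambda>n. t - (t - a) / real (n + 2))"
  have s: "s n \<in> {a<..<t}" for n
  proof -
    have "(t - a) / real (n + 2) < (t - a) / 1" using t by (intro divide_strict_left_mono) auto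
    thus ?thesis using t by (auto simp: s_def)
  qed
  have "(\<lambda>n. inverse (real (n + 2))) \<longlonglongrightarrow> 0"
    using LIMSEQ_ignore_initial_segment[OF LIMSEQ_inverse_real_of_nat, of 1] by (simp add: add_ac)
  from tendsto_mult_left[OF this, of "t - a"] have "(\<lambda>n. (t - a) / real (n + 2)) \<longlonglongrightarrow> 0"
    by (simp add: divide_inverse)
  from tendsto_diff[OF tendsto_const[of t] this] have s_lim: "s \<longlonglongrightarrow> t" by (simp add: s_def)
  have fl: "filterlim s (at t within {a<..b}) sequentially"
  proof -
    have "s n \<in> {a<..b} \<and> s n \<noteq> t" for n using s[of n] t by auto
    thus ?thesis unfolding filterlim_at using s_lim by auto
  qed
  have "(I 1 g has_real_derivative \<phi>' t * g t) (at t within {a<..b})"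
    using I1_deriv[OF g t] by (simp add: has_real_derivative_iff_has_vector_derivative)
  hence 1: "(\<lambda>n. (I 1 g (s n) - I 1 g t) / (s n - t)) \<longlonglongrightarrow> \<phi>' t * g t"
    unfolding has_field_derivative_iff by (rule filterlim_compose[OF _ fl])
  have "(\<phi> has_real_derivative \<phi>' t) (at t within {a<..b})"
    using deriv[of t] t by (auto intro: DERIV_subset)
  hence 2: "(\<lambda>n. (\<phi> (s n) - \<phi> t) / (s n - t)) \<longlonglongrightarrow> \<phi>' t"
    unfolding has_field_derivative_iff by (rule filterlim_compose[OF _ fl])
  have p: "\<phi>' t \<noteq> 0" using pos'[of t] t by auto
  \<comment> \<open>Dividing by the quotients of \<phi> trades the denominator s(n) - t for
    \<phi>(s(n)) - \<phi>(t) and removes the factor \<open>\<phi>' t\<close>.\<close>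
  have "(\<lambda>n. ((I 1 g (s n) - I 1 g t) / (s n - t)) / ((\<phi> (s n) - \<phi> t) / (s n - t))) \<longlonglongrightarrow> \<phi>' t * g t / \<phi>' t"
    by (intro tendsto_divide 1 2 p)
  also have "(\<lambda>n. ((I 1 g (s n) - I 1 g t) / (s n - t)) / ((\<phi> (s n) - \<phi> t) / (s n - t))) =
      (\<lambda>n. (I (1 + \<beta>) v t - I (1 + \<beta>) v (s n)) / (\<phi> t - \<phi> (s n)))"
  proof
    fix n
    have "s n \<noteq> t" "\<phi> t \<noteq> \<phi> (s n)" "s n \<in> {a<..b}" using s[of n] t phi_less[of "s n" t] by auto
    thus "((I 1 g (s n) - I 1 g t) / (s n - t)) / ((\<phi> (s n) - \<phi> t) / (s n - t)) =
        (I (1 + \<beta>) v t - I (1 + \<beta>) v (s n)) / (\<phi> t - \<phi> (s n))"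
      using eq[OF t] eq[of "s n"]
        minus_divide_divide[of "I (1 + \<beta>) v t - I (1 + \<beta>) v (s n)" "\<phi> t - \<phi> (s n)"] by simp
  qed
  finally have "(\<lambda>n. (I (1 + \<beta>) v t - I (1 + \<beta>) v (s n)) / (\<phi> t - \<phi> (s n))) \<longlonglongrightarrow> g t"
    using p by simp
  with I_left_derivative[OF v \<beta> t ex s s_lim] show ?thesis
    by (rule LIMSEQ_unique)
qed

subsection \<open>The boundary value problem\<close>

lemma phi_deriv_SucI:
  assumes "(phi_deriv \<phi>' a b n w has_vector_derivative \<phi>' t * d) (at t within {a<..b})" "t \<in> {a<..b}"
  shows "phi_deriv \<phi>' a b (Suc n) w t = d"
  using vector_derivative_within[OF at_within_nontrivial[OF assms(2)] assms(1)] pos'[of t] assms(2) by simp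

text \<open>The two orders in the Hilfer derivative are (1 - \<nu>)(2 - \<mu>) = 2 - \<xi> and
  \<nu>(2 - \<mu>) = \<xi> - \<mu>, so the lemmas that follow speak of \<mu> and \<xi>
  alone.\<close>

lemma hilfer_2_unfold:
  assumes "\<xi> = \<mu> + \<nu> * (2 - \<mu>)"
  shows "hilfer_deriv \<phi> \<phi>' a b 2 \<mu> \<nu> y = I (\<xi> - \<mu>) (phi_deriv \<phi>' a b 2 (I (2 - \<xi>) y))"
    and "hilfer_deriv_exists \<phi> \<phi>' a b 2 \<mu> \<nu> y \<longleftrightarrow>
      (\<forall>t\<in>{a<..b}. I_exists (2 - \<xi>) y t) \<and> phi_deriv_exists \<phi>' a b 2 (I (2 - \<xi>) y) \<and>
      (\<forall>t\<in>{a<..b}. I_exists (\<xi> - \<mu>) (phi_deriv \<phi>' a b 2 (I (2 - \<xi>) y)) t)"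
proof -
  have eq: "(1 - \<nu>) * (real 2 - \<mu>) = 2 - \<xi>" "\<nu> * (real 2 - \<mu>) = \<xi> - \<mu>"
    using assms by (auto simp: algebra_simps)
  show "hilfer_deriv \<phi> \<phi>' a b 2 \<mu> \<nu> y = I (\<xi> - \<mu>) (phi_deriv \<phi>' a b 2 (I (2 - \<xi>) y))"
    unfolding hilfer_deriv_def eq ..
  show "hilfer_deriv_exists \<phi> \<phi>' a b 2 \<mu> \<nu> y \<longleftrightarrow>
      (\<forall>t\<in>{a<..b}. I_exists (2 - \<xi>) y t) \<and> phi_deriv_exists \<phi>' a b 2 (I (2 - \<xi>) y) \<and>
      (\<forall>t\<in>{a<..b}. I_exists (\<xi> - \<mu>) (phi_deriv \<phi>' a b 2 (I (2 - \<xi>) y)) t)"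
    unfolding hilfer_deriv_exists_def eq Let_def ..
qed

text \<open>Termwise integration, by \<open>I_power\<close> and the semigroup law. It serves the
  boundary values with \<delta> = \<delta>(i), and \<open>hilfer_backward_0\<close> with \<xi> =
  \<mu> and \<delta> = 2 - \<mu>.\<close>

lemma integral_of_solution:
  assumes \<xi>: "0 < \<xi>" and \<mu>: "0 \<le> \<mu>" and \<delta>: "0 \<le> \<delta>" and g: "L1 g" "I_exists \<mu> g t" "I_exists (\<mu> + \<delta>) g t"
    and y: "\<And>s. s \<in> {a<..b} \<Longrightarrow> y s = C * (\<phi> s - \<phi> a) powr (\<xi> - 1) + I \<mu> g s" and t: "t \<in> {a<..b}"
  shows "I \<delta> y t = C * (Gamma \<xi> / Gamma (\<xi> + \<delta>) * (\<phi> t - \<phi> a) powr (\<xi> + \<delta> - 1)) + I (\<mu> + \<delta>) g t"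
proof -
  have g': "I_exists (\<delta> + \<mu>) g t" using g by (simp add: add.commute)
  have "I \<delta> y t = I \<delta> (\<lambda>s. C * (\<phi> s - \<phi> a) powr (\<xi> - 1) + I \<mu> g s) t"
    by (rule I_cong) (use y t in auto)
  also have "\<dots> = C * I \<delta> (\<lambda>s. (\<phi> s - \<phi> a) powr (\<xi> - 1)) t + I \<delta> (I \<mu> g) t"
    using I_power(1)[of t \<delta> \<xi>] I_semigroup(1)[OF t \<delta> \<mu> g(1) g'] t \<xi> \<delta>
    by (subst I_add(2)) (auto intro!: I_cmult(1) simp: I_cmult(2))
  also have "I \<delta> (I \<mu> g) t = I (\<mu> + \<delta>) g t"
    using I_semigroup(2)[OF t \<delta> \<mu> g(1) g'] by (simp add: add.commute)
  finally show ?thesis using I_power(2)[of t \<delta> \<xi>] t \<xi> \<delta> by simp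
qed

text \<open>Inserting the representation makes the condition linear in C. Its coefficient,
  X(b)^(\<xi> - 1) minus Gamma(\<xi>) times the sum in \<Lambda>, is \<Lambda> Gamma(\<xi>) and
  hence nonzero.\<close>

lemma boundary_condition_iff:
  fixes \<delta> lam \<tau> :: "nat \<Rightarrow> real"
  assumes \<xi>: "1 < \<xi>" "\<xi> \<le> 2" and \<mu>: "1 \<le> \<mu>" and g: "g \<in> weighted_space \<phi> a b (2 - \<xi>)"
    and y: "\<And>s. s \<in> {a<..b} \<Longrightarrow> y s = C * (\<phi> s - \<phi> a) powr (\<xi> - 1) + I \<mu> g s"
    and \<delta>: "\<And>i. i \<in> {1..m} \<Longrightarrow> \<delta> i > 0" and \<tau>: "\<And>i. i \<in> {1..m} \<Longrightarrow> \<tau> i \<in> {a..b}"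
    and \<Lambda>: "\<Lambda> = (\<phi> b - \<phi> a) powr (\<xi> - 1) / Gamma \<xi>
           - (\<Sum>i=1..m. lam i / Gamma (\<xi> + \<delta> i) * (\<phi> (\<tau> i) - \<phi> a) powr (\<xi> + \<delta> i - 1))" "\<Lambda> \<noteq> 0"
  shows "y b = (\<Sum>i=1..m. lam i * I (\<delta> i) y (\<tau> i)) \<longleftrightarrow>
    C = 1 / (\<Lambda> * Gamma \<xi>) * ((\<Sum>i=1..m. lam i * I (\<mu> + \<delta> i) g (\<tau> i)) - I \<mu> g b)"
proof -
  have g1: "L1 g" using weighted_L1[OF g] \<xi> by simp
  have G: "Gamma \<xi> \<noteq> 0" using Gamma_real_nonzero[of \<xi>] \<xi> by simp
  have I\<tau>: "I (\<delta> i) y (\<tau> i) = C * Gamma \<xi> * (1 / Gamma (\<xi> + \<delta> i) * (\<phi> (\<tau> i) - \<phi> a) powr (\<xi> + \<delta> i - 1)) + I (\<mu> + \<delta> i) g (\<tau> i)"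
    if i: "i \<in> {1..m}" for i
  \<comment> \<open>A node may be a, outside (a, b]; there both sides vanish, as the integrals run
    over an empty interval and \<open>0 powr x = 0\<close>.\<close>
  proof (cases "\<tau> i = a")
    case True
    thus ?thesis using \<delta>[OF i] \<mu> by (simp add: I_at_a)
  next
    case False
    hence t: "\<tau> i \<in> {a<..b}" using \<tau>[OF i] by auto
    show ?thesis
      using integral_of_solution[of \<xi> \<mu> "\<delta> i" g "\<tau> i" y C, OF _ _ _ g1 _ _ y t] \<xi> \<mu> \<delta>[OF i] t
        L1_imp_I_exists[OF g1, of _ "\<tau> i"] by simp
  qed
  have "(\<Sum>i=1..m. lam i * I (\<delta> i) y (\<tau> i)) =
      (\<Sum>i=1..m. C * Gamma \<xi> * (lam i / Gamma (\<xi> + \<delta> i) * (\<phi> (\<tau> i) - \<phi> a) powr (\<xi> + \<delta> i - 1))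
        + lam i * I (\<mu> + \<delta> i) g (\<tau> i))"
    by (rule sum.cong) (auto simp: I\<tau> algebra_simps)
  also have "\<dots> = C * Gamma \<xi> * (\<Sum>i=1..m. lam i / Gamma (\<xi> + \<delta> i) * (\<phi> (\<tau> i) - \<phi> a) powr (\<xi> + \<delta> i - 1))
      + (\<Sum>i=1..m. lam i * I (\<mu> + \<delta> i) g (\<tau> i))"
    by (simp add: sum.distrib sum_distrib_left)
  also have "(\<Sum>i=1..m. lam i / Gamma (\<xi> + \<delta> i) * (\<phi> (\<tau> i) - \<phi> a) powr (\<xi> + \<delta> i - 1)) =
      (\<phi> b - \<phi> a) powr (\<xi> - 1) / Gamma \<xi> - \<Lambda>"
    using \<Lambda>(1) by simp
  finally have "y b - (\<Sum>i=1..m. lam i * I (\<delta> i) y (\<tau> i)) =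
      C * (\<Lambda> * Gamma \<xi>) - ((\<Sum>i=1..m. lam i * I (\<mu> + \<delta> i) g (\<tau> i)) - I \<mu> g b)"
    using y[of b] ab G by (simp add: algebra_simps)
  thus ?thesis using G \<Lambda>(2) by (auto simp: field_simps)
qed

text \<open>\<open>I_bound\<close> with c = \<xi> - 1 gives |I^\<mu> g| \<le> K X^(\<xi> + \<mu> -
  2); division by X^(\<xi> - 1) leaves K X^(\<mu> - 1), which tends to 0 at a as \<mu> > 1.\<close>

lemma solution_tendsto_0:
  assumes \<xi>: "1 < \<xi>" "\<xi> \<le> 2" and \<mu>: "1 < \<mu>" and g: "g \<in> weighted_space \<phi> a b (2 - \<xi>)"
  shows "((\<lambda>t. I \<mu> g t / (\<phi> t - \<phi> a) powr (\<xi> - 1)) \<longlongrightarrow> 0) (at_right a)"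
    and "(\<And>s. s \<in> {a<..b} \<Longrightarrow> y s = C * (\<phi> s - \<phi> a) powr (\<xi> - 1) + I \<mu> g s) \<Longrightarrow> (y \<longlongrightarrow> 0) (at_right a)"
proof -
  obtain M where M: "M \<ge> 0" "\<And>s. s \<in> {a<..b} \<Longrightarrow> \<bar>g s\<bar> \<le> M * (\<phi> s - \<phi> a) powr (- (2 - \<xi>))"
    using weighted_spaceE[OF g] by blast
  define K where "K = M * Gamma (\<xi> - 1) / Gamma (\<xi> - 1 + \<mu>)"
  show *: "((\<lambda>t. I \<mu> g t / (\<phi> t - \<phi> a) powr (\<xi> - 1)) \<longlongrightarrow> 0) (at_right a)"
  proof (rule Lim_null_comparison)
    show "eventually (\<lambda>t. norm (I \<mu> g t / (\<phi> t - \<phi> a) powr (\<xi> - 1)) \<le> K * (\<phi> t - \<phi> a) powr (\<mu> - 1)) (at_right a)"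
      using eventually_at_right_a
    proof eventually_elim
      case (elim t)
      have X: "\<phi> t - \<phi> a > 0" using phi_less[of a t] elim by simp
      have "\<bar>I \<mu> g t\<bar> \<le> K * (\<phi> t - \<phi> a) powr (\<xi> - 1 + \<mu> - 1)"
        unfolding K_def using M elim \<xi> \<mu> by (intro I_bound) auto
      also have "\<dots> = K * (\<phi> t - \<phi> a) powr (\<mu> - 1) * (\<phi> t - \<phi> a) powr (\<xi> - 1)"
        using X by (simp add: mult.assoc add_ac flip: powr_add)
      finally show ?case using X by (simp add: divide_le_eq)
    qed
    show "((\<lambda>t. K * (\<phi> t - \<phi> a) powr (\<mu> - 1)) \<longlongrightarrow> 0) (at_right a)"
      using X_powr_tendsto_0[of "\<mu> - 1"] \<mu> by (intro tendsto_mult_right_zero) auto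
  qed
  assume y: "\<And>s. s \<in> {a<..b} \<Longrightarrow> y s = C * (\<phi> s - \<phi> a) powr (\<xi> - 1) + I \<mu> g s"
  have "((\<lambda>t. (C + I \<mu> g t / (\<phi> t - \<phi> a) powr (\<xi> - 1)) * (\<phi> t - \<phi> a) powr (\<xi> - 1)) \<longlongrightarrow> (C + 0) * 0) (at_right a)"
    using \<xi> by (intro tendsto_intros * X_powr_tendsto_0) auto
  moreover have "eventually (\<lambda>t. (C + I \<mu> g t / (\<phi> t - \<phi> a) powr (\<xi> - 1)) * (\<phi> t - \<phi> a) powr (\<xi> - 1) = y t) (at_right a)"
    using eventually_at_right_a
  proof eventually_elim
    case (elim t)
    thus ?case using y[OF elim] phi_less[of a t] by (simp add: distrib_right)
  qed
  ultimately show "(y \<longlongrightarrow> 0) (at_right a)" by (auto intro: Lim_transform_eventually)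
qed

section \<open>From the boundary value problem to the integral equation and back\<close>

lemma hilfer_forward:
  assumes \<xi>: "\<mu> \<le> \<xi>" "\<xi> \<le> 2" and \<mu>: "1 < \<mu>" and y: "y \<in> weighted_space \<phi> a b (2 - \<xi>)" "(y \<longlongrightarrow> 0) (at_right a)"
    and ex: "phi_deriv_exists \<phi>' a b 2 (I (2 - \<xi>) y)"
      "\<And>t. t \<in> {a<..b} \<Longrightarrow> I_exists (\<xi> - \<mu>) (phi_deriv \<phi>' a b 2 (I (2 - \<xi>) y)) t"
    and g: "g \<in> weighted_space \<phi> a b (2 - \<xi>)"
      "\<And>t. t \<in> {a<..b} \<Longrightarrow> g t = I (\<xi> - \<mu>) (phi_deriv \<phi>' a b 2 (I (2 - \<xi>) y)) t"
  obtains C where "\<And>t. t \<in> {a<..b} \<Longrightarrow> y t = C * (\<phi> t - \<phi> a) powr (\<xi> - 1) + I \<mu> g t"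
proof -
  define v where "v = phi_deriv \<phi>' a b 2 (I (2 - \<xi>) y)"
  have v: "L1 v"
  \<comment> \<open>For \<xi> = \<mu> the outer integral has order 0 and its existence clause is
    vacuous; integrability of v then comes from v = g. Otherwise existence at b suffices, since 0 <
    \<xi> - \<mu> \<le> 1.\<close>
  proof (cases "\<xi> = \<mu>")
    case True
    have "L1 v \<longleftrightarrow> L1 g" by (rule set_integrable_cong) (use g(2) True in \<open>auto simp: v_def\<close>)
    thus ?thesis using weighted_L1[OF g(1)] \<xi> \<mu> by simp
  next
    case False
    thus ?thesis using I_exists_imp_L1[of "\<xi> - \<mu>" v] ex(2)[of b] \<xi> \<mu> ab by (simp add: v_def)
  qed
  obtain C where C: "\<And>t. t \<in> {a<..b} \<Longrightarrow> y t = C * (\<phi> t - \<phi> a) powr (\<xi> - 1) + I \<xi> v t"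
    using hilfer_representation[OF _ _ y ex(1)] v \<xi> \<mu> unfolding v_def by force
  have "I \<mu> g t = I \<xi> v t" if t: "t \<in> {a<..b}" for t
  proof -
    have "I \<mu> g t = I \<mu> (I (\<xi> - \<mu>) v) t" by (rule I_cong) (use g(2) t in \<open>auto simp: v_def\<close>)
    also have "\<dots> = I \<xi> v t"
      using I_semigroup(2)[of t \<mu> "\<xi> - \<mu>" v] L1_imp_I_exists[OF v, of \<xi> t] \<xi> \<mu> t v by simp
    finally show ?thesis .
  qed
  thus ?thesis using that[of C] C by auto
qed

text \<open>I^(2 - \<mu>) y works out to c X + I^1 (I^1 g) with g continuous, so both derivatives
  exist by the fundamental theorem. Existence is thus a conclusion here.\<close>

lemma hilfer_backward_0:
  assumes \<mu>: "1 < \<mu>" "\<mu> < 2" and g: "g \<in> weighted_space \<phi> a b (2 - \<mu>)"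
    and y: "\<And>s. s \<in> {a<..b} \<Longrightarrow> y s = C * (\<phi> s - \<phi> a) powr (\<mu> - 1) + I \<mu> g s"
  shows "phi_deriv_exists \<phi>' a b 2 (I (2 - \<mu>) y)"
    and "t \<in> {a<..b} \<Longrightarrow> phi_deriv \<phi>' a b 2 (I (2 - \<mu>) y) t = g t"
proof -
  define w where "w = I (2 - \<mu>) y"
  \<comment> \<open>From I^(2 - \<mu>) X^(\<mu> - 1) = Gamma(\<mu>) X.\<close>
  define c where "c = C * Gamma \<mu>"
  have g1: "L1 g" and gc: "continuous_on {a<..b} g"
    using weighted_L1[OF g] weighted_spaceE[OF g] \<mu> by auto
  have ex: "I_exists \<alpha> g t" if "\<alpha> \<ge> 1" "t \<in> {a<..b}" for \<alpha> t
    using L1_imp_I_exists[OF g1 that(1), of t] that by simp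
  have w: "w t = c * (\<phi> t - \<phi> a) + I 1 (I 1 g) t" if t: "t \<in> {a<..b}" for t
    unfolding w_def c_def
    using integral_of_solution[of \<mu> \<mu> "2 - \<mu>" g t y C, OF _ _ _ g1 ex ex y] t \<mu>
      I_semigroup(2)[of t 1 1 g] ex[of 2 t] g1 phi_less[of a t] by (simp add: Gamma_numeral)
  have dw: "(w has_vector_derivative \<phi>' t * (c + I 1 g t)) (at t within {a<..b})" if t: "t \<in> {a<..b}" for t
  proof (rule has_vector_derivative_transform[OF t w])
    have "(\<phi> has_real_derivative \<phi>' t) (at t within {a<..b})"
      using deriv[of t] t by (auto intro: DERIV_subset)
    moreover have "(I 1 (I 1 g) has_real_derivative \<phi>' t * I 1 g t) (at t within {a<..b})"
      using I1_deriv[OF I_L1[OF g1, of 1] I_continuous[OF g1, of 1] t]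
      by (simp add: has_real_derivative_iff_has_vector_derivative)
    ultimately have "((\<lambda>t. c * (\<phi> t - \<phi> a) + I 1 (I 1 g) t) has_real_derivative \<phi>' t * (c + I 1 g t)) (at t within {a<..b})"
      by (auto intro!: derivative_eq_intros simp: algebra_simps)
    thus "((\<lambda>t. c * (\<phi> t - \<phi> a) + I 1 (I 1 g) t) has_vector_derivative \<phi>' t * (c + I 1 g t)) (at t within {a<..b})"
      by (simp add: has_real_derivative_iff_has_vector_derivative)
  qed
  have p: "phi_deriv \<phi>' a b 1 w t = c + I 1 g t" if "t \<in> {a<..b}" for t
    using phi_deriv_SucI[of 0 w t] dw[OF that] that by simp
  have dp: "(phi_deriv \<phi>' a b 1 w has_vector_derivative \<phi>' t * g t) (at t within {a<..b})" if t: "t \<in> {a<..b}" for t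
  proof (rule has_vector_derivative_transform[OF t p])
    show "((\<lambda>t. c + I 1 g t) has_vector_derivative \<phi>' t * g t) (at t within {a<..b})"
      using has_vector_derivative_add[OF has_vector_derivative_const I1_deriv[OF g1 gc t]] by simp
  qed
  show "t \<in> {a<..b} \<Longrightarrow> phi_deriv \<phi>' a b 2 (I (2 - \<mu>) y) t = g t"
    using phi_deriv_SucI[of 1 w t] dp by (simp add: w_def numeral_2_eq_2)
  show "phi_deriv_exists \<phi>' a b 2 (I (2 - \<mu>) y)"
    unfolding phi_deriv_exists_def w_def[symmetric]
  proof (intro allI impI ballI)
    fix k :: nat and t assume "k < 2" "t \<in> {a<..b}"
    thus "phi_deriv \<phi>' a b k w differentiable (at t within {a<..b})"
      using differentiableI_vector[OF dw[of t]] differentiableI_vector[OF dp[of t]]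
      by (cases "k = 0") (auto simp: less_2_cases_iff)
  qed
qed

text \<open>The assumed existence of the derivative supplies an integrable v. The representations of
  y by g and by v are compared, and the integrals are peeled off one at a time.\<close>

lemma hilfer_backward_pos:
  assumes \<xi>: "\<mu> < \<xi>" "\<xi> \<le> 2" and \<mu>: "1 < \<mu>" and y1: "y \<in> weighted_space \<phi> a b (2 - \<xi>)"
    and ex: "phi_deriv_exists \<phi>' a b 2 (I (2 - \<xi>) y)"
      "\<And>t. t \<in> {a<..b} \<Longrightarrow> I_exists (\<xi> - \<mu>) (phi_deriv \<phi>' a b 2 (I (2 - \<xi>) y)) t"
    and g: "g \<in> weighted_space \<phi> a b (2 - \<xi>)"
    and y: "\<And>s. s \<in> {a<..b} \<Longrightarrow> y s = A * (\<phi> s - \<phi> a) powr (\<xi> - 1) + I \<mu> g s"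
    and t: "t \<in> {a<..b}"
  shows "I (\<xi> - \<mu>) (phi_deriv \<phi>' a b 2 (I (2 - \<xi>) y)) t = g t"
proof -
  define v where "v = phi_deriv \<phi>' a b 2 (I (2 - \<xi>) y)"
  have v: "L1 v" using I_exists_imp_L1[of "\<xi> - \<mu>" v] ex(2)[of b] \<xi> \<mu> ab by (simp add: v_def)
  have g1: "L1 g" and gc: "continuous_on {a<..b} g"
    using weighted_L1[OF g] weighted_spaceE[OF g] \<mu> \<xi> by auto
  have exv: "I_exists \<alpha> v t" if "\<alpha> \<ge> 1" "t \<in> {a<..b}" for \<alpha> t
    using L1_imp_I_exists[OF v that(1), of t] that by simp
  have exg: "I_exists \<alpha> g t" if "\<alpha> \<ge> 1" "t \<in> {a<..b}" for \<alpha> t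
    using L1_imp_I_exists[OF g1 that(1), of t] that by simp
  have y0: "(y \<longlongrightarrow> 0) (at_right a)" using solution_tendsto_0(2)[OF _ \<xi>(2) \<mu> g y] \<xi> \<mu> by simp
  obtain C where C: "\<And>t. t \<in> {a<..b} \<Longrightarrow> y t = C * (\<phi> t - \<phi> a) powr (\<xi> - 1) + I \<xi> v t"
    using hilfer_representation[OF _ _ y1 y0 ex(1)] v \<xi> \<mu> unfolding v_def by force
  \<comment> \<open>Division by X^(\<xi> - 1) leaves the difference of the constants. I^\<xi> v is
    written as I^(\<xi> - 1) (I^1 v) because I^1 v tends to 0 at a, whereas v itself has no known
    bound there.\<close>
  have "A = C"
  proof -
    have "((\<lambda>t. I \<mu> g t / (\<phi> t - \<phi> a) powr (\<xi> - 1) - I (\<xi> - 1) (I 1 v) t / (\<phi> t - \<phi> a) powr (\<xi> - 1)) \<longlongrightarrow> 0 - 0) (at_right a)"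
      using \<xi> \<mu> by (intro tendsto_diff solution_tendsto_0(1) I_quotient_tendsto_0 I1_tendsto_0 g v) auto
    moreover have "eventually (\<lambda>t. I \<mu> g t / (\<phi> t - \<phi> a) powr (\<xi> - 1) - I (\<xi> - 1) (I 1 v) t / (\<phi> t - \<phi> a) powr (\<xi> - 1) = C - A) (at_right a)"
      using eventually_at_right_a
    proof eventually_elim
      case (elim t)
      have "I (\<xi> - 1) (I 1 v) t = I \<xi> v t"
        using I_semigroup(2)[OF elim, of "\<xi> - 1" 1 v] exv[of \<xi> t] v \<xi> \<mu> elim by simp
      hence "I \<mu> g t - I (\<xi> - 1) (I 1 v) t = (C - A) * (\<phi> t - \<phi> a) powr (\<xi> - 1)"
        using y[OF elim] C[OF elim] by (simp add: algebra_simps)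
      thus ?case using phi_less[of a t] elim by (simp flip: diff_divide_distrib)
    qed
    ultimately have "((\<lambda>t::real. C - A) \<longlongrightarrow> 0) (at_right a)"
      by (auto dest: Lim_transform_eventually)
    thus ?thesis by (simp add: tendsto_const_iff)
  qed
  hence Ig: "I \<mu> g t = I \<xi> v t" if "t \<in> {a<..b}" for t using y[OF that] C[OF that] by simp
  \<comment> \<open>I^(2 - \<mu>) turns I^\<mu> g = I^\<xi> v into I^2 g = I^(2 + \<xi> - \<mu>) v.
    One I^1 is cancelled here by continuity, the last by \<open>I_pointwise_eq\<close>, whose order
    \<xi> - \<mu> lies in (0, 1).\<close>
  have "I 1 g s = I (1 + (\<xi> - \<mu>)) v s" if s: "s \<in> {a<..b}" for s
  proof (rule I1_cancel[OF _ _ _ _ _ s])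
    show "L1 (I 1 g)" "L1 (I (1 + (\<xi> - \<mu>)) v)" using g1 v \<xi> by (auto intro!: I_L1)
    show "continuous_on {a<..b} (I 1 g)" "continuous_on {a<..b} (I (1 + (\<xi> - \<mu>)) v)"
      using g1 v \<xi> by (auto intro!: I_continuous)
    fix t assume t: "t \<in> {a<..b}"
    have "I 1 (I 1 g) t = I (2 - \<mu>) (I \<mu> g) t"
      using I_semigroup(2)[OF t, of 1 1 g] I_semigroup(2)[OF t, of "2 - \<mu>" \<mu> g] exg[of 2 t] g1 t \<xi> \<mu> by simp
    also have "\<dots> = I (2 - \<mu>) (I \<xi> v) t"
      by (rule I_cong) (use Ig t in auto)
    also have "\<dots> = I 1 (I (1 + (\<xi> - \<mu>)) v) t"
      using I_semigroup(2)[OF t, of "2 - \<mu>" \<xi> v] I_semigroup(2)[OF t, of 1 "1 + (\<xi> - \<mu>)" v]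
        exv[of "2 - \<mu> + \<xi>" t] v t \<xi> \<mu> by (simp add: algebra_simps)
    finally show "I 1 (I 1 g) t = I 1 (I (1 + (\<xi> - \<mu>)) v) t" .
  qed
  from I_pointwise_eq[OF v g1 gc _ _ t _ this] show ?thesis
    using ex(2)[OF t] \<xi> \<mu> by (simp add: v_def)
qed

end

theorem theorem3p2:
  fixes a b \<mu> \<nu> \<xi> \<Lambda> :: real
    and \<phi> \<phi>' :: "real \<Rightarrow> real"
    and m :: nat
    and \<delta> lam \<tau> :: "nat \<Rightarrow> real"
    and f :: "real \<times> real \<times> real \<Rightarrow> real"
    and y :: "real \<Rightarrow> real"
  assumes "0 \<le> a" and "a < b"
    and "\<And>t. t \<in> {a..b} \<Longrightarrow> (\<phi> has_real_derivative \<phi>' t) (at t within {a..b})"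
    and "continuous_on {a..b} \<phi>'"
    and "mono_on {a..b} \<phi>"
    and "\<And>t. t \<in> {a..b} \<Longrightarrow> \<phi>' t \<noteq> 0"
    and "1 < \<mu>" and "\<mu> < 2" and "0 \<le> \<nu>" and "\<nu> \<le> 1"
    and "\<xi> = \<mu> + \<nu> * (2 - \<mu>)"
    and "m \<ge> 1"
    and "\<And>i. i \<in> {1..m} \<Longrightarrow> \<delta> i > 0"
    and "strict_mono_on {1..m} \<tau>"
    and "\<And>i. i \<in> {1..m} \<Longrightarrow> \<tau> i \<in> {a..b}"
    and "\<Lambda> = (\<phi> b - \<phi> a) powr (\<xi> - 1) / Gamma \<xi>
           - (\<Sum>i=1..m. lam i / Gamma (\<xi> + \<delta> i) * (\<phi> (\<tau> i) - \<phi> a) powr (\<xi> + \<delta> i - 1))"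
    and "\<Lambda> \<noteq> 0"
    and "continuous_on ({a<..b} \<times> UNIV \<times> UNIV) f"
    and "\<And>z. z \<in> weighted_space \<phi> a b (2 - \<xi>) \<Longrightarrow> hilfer_deriv_exists \<phi> \<phi>' a b 2 \<mu> \<nu> z \<Longrightarrow>
           (\<lambda>t. f (t, z t, hilfer_deriv \<phi> \<phi>' a b 2 \<mu> \<nu> z t)) \<in> weighted_space \<phi> a b (2 - \<xi>)"
    and "y \<in> weighted_space \<phi> a b (2 - \<xi>)"
    and "\<nu> = 0 \<or> hilfer_deriv_exists \<phi> \<phi>' a b 2 \<mu> \<nu> y"
  shows
    "(hilfer_deriv_exists \<phi> \<phi>' a b 2 \<mu> \<nu> y \<and>
      (\<forall>t\<in>{a<..b}. hilfer_deriv \<phi> \<phi>' a b 2 \<mu> \<nu> y t = f (t, y t, hilfer_deriv \<phi> \<phi>' a b 2 \<mu> \<nu> y t)) \<and>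
      (y \<longlongrightarrow> 0) (at_right a) \<and>
      y b = (\<Sum>i=1..m. lam i * frac_integral \<phi> \<phi>' a (\<delta> i) y (\<tau> i)))
     \<longleftrightarrow>
     (\<exists>g \<in> weighted_space \<phi> a b (2 - \<xi>).
        let A = 1 / (\<Lambda> * Gamma \<xi>) *
                  ((\<Sum>i=1..m. lam i * frac_integral \<phi> \<phi>' a (\<mu> + \<delta> i) g (\<tau> i))
                   - frac_integral \<phi> \<phi>' a \<mu> g b)
        in (\<forall>t\<in>{a<..b}. g t = f (t, (\<phi> t - \<phi> a) powr (\<xi> - 1) * A + frac_integral \<phi> \<phi>' a \<mu> g t, g t)) \<and>
           (\<forall>t\<in>{a<..b}. y t = (\<phi> t - \<phi> a) powr (\<xi> - 1) * A + frac_integral \<phi> \<phi>' a \<mu> g t))"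
proof -
  interpret phi_interval a b \<phi> \<phi>'
  proof
    fix t assume t: "t \<in> {a..b}"
    have "at t within {a..b} \<noteq> bot" using \<open>a < b\<close> t by (simp add: trivial_limit_within)
    from mono_on_has_real_derivative_nonneg[OF assms(5) assms(3)[OF t] t this]
    show "\<phi>' t > 0" using assms(6)[OF t] by simp
  qed (use assms in auto)
  have \<xi>: "\<mu> \<le> \<xi>" "1 < \<xi>" "\<xi> \<le> 2"
  proof -
    have "0 \<le> \<nu> * (2 - \<mu>)" "\<nu> * (2 - \<mu>) \<le> 1 * (2 - \<mu>)"
      using assms by (auto intro!: mult_nonneg_nonneg mult_right_mono)
    thus "\<mu> \<le> \<xi>" "1 < \<xi>" "\<xi> \<le> 2" using assms(7,11) by simp_all
  qed
  note hilfer = hilfer_2_unfold[OF assms(11)]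
  let ?D = "hilfer_deriv \<phi> \<phi>' a b 2 \<mu> \<nu> y"
  let ?A = "\<lambda>g. 1 / (\<Lambda> * Gamma \<xi>) * ((\<Sum>i=1..m. lam i * I (\<mu> + \<delta> i) g (\<tau> i)) - I \<mu> g b)"
  note boundary = boundary_condition_iff[OF \<xi>(2,3) _ _ _ assms(13,15,16,17), of \<mu> _ y]
  show ?thesis (is "?P \<longleftrightarrow> ?Q")
  proof
    assume P: ?P
    \<comment> \<open>The right-hand side along y is taken instead of \<open>?D\<close>, because the
      hypothesis on f places exactly this function in the weighted space; on (a, b] the two agree by
      the equation.\<close>
    define g where "g = (\<lambda>t. f (t, y t, ?D t))"
    have g: "g \<in> weighted_space \<phi> a b (2 - \<xi>)"
      unfolding g_def using P assms(19)[OF assms(20)] by blast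
    have gD: "g t = ?D t" if "t \<in> {a<..b}" for t using P that by (simp add: g_def)
    obtain C where C: "\<And>t. t \<in> {a<..b} \<Longrightarrow> y t = C * (\<phi> t - \<phi> a) powr (\<xi> - 1) + I \<mu> g t"
      by (rule hilfer_forward[of \<mu> \<xi> y g]) (use P \<xi> assms(7,20) g gD in \<open>auto simp: hilfer\<close>)
    have "C = ?A g" using boundary[of g C] C P g assms(7) by simp
    hence yA: "y t = (\<phi> t - \<phi> a) powr (\<xi> - 1) * ?A g + I \<mu> g t" if "t \<in> {a<..b}" for t
      using C[OF that] by (simp only: mult.commute)
    have gf: "g t = f (t, (\<phi> t - \<phi> a) powr (\<xi> - 1) * ?A g + I \<mu> g t, g t)" if "t \<in> {a<..b}" for t
      unfolding yA[OF that, symmetric] unfolding gD[OF that] using P that by blast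
    show ?Q
      unfolding Let_def using g yA gf by blast
  next
    assume ?Q
    then obtain g where g: "g \<in> weighted_space \<phi> a b (2 - \<xi>)"
      and gf: "\<And>t. t \<in> {a<..b} \<Longrightarrow> g t = f (t, (\<phi> t - \<phi> a) powr (\<xi> - 1) * ?A g + I \<mu> g t, g t)"
      and yA: "\<And>t. t \<in> {a<..b} \<Longrightarrow> y t = (\<phi> t - \<phi> a) powr (\<xi> - 1) * ?A g + I \<mu> g t"
      unfolding Let_def by blast
    have y: "y t = ?A g * (\<phi> t - \<phi> a) powr (\<xi> - 1) + I \<mu> g t" if "t \<in> {a<..b}" for t
      using yA[OF that] by (simp only: mult.commute)
    \<comment> \<open>For \<nu> = 0 the integral equation itself yields existence of the derivative;
      for \<nu> > 0 existence is taken from the last assumption and only the value is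
      computed.\<close>
    have ex: "hilfer_deriv_exists \<phi> \<phi>' a b 2 \<mu> \<nu> y \<and> (\<forall>t\<in>{a<..b}. ?D t = g t)"
    proof (cases "\<nu> = 0")
      case True
      hence eq: "\<xi> = \<mu>" using assms(11) by simp
      have "I_exists (2 - \<mu>) y t" if "t \<in> {a<..b}" for t
        using weighted_I_exists[OF assms(20) _ _ that] eq assms(7,8) by simp
      thus ?thesis
        using hilfer_backward_0[OF assms(7,8) g[unfolded eq] y[unfolded eq]] by (simp add: hilfer eq)
    next
      case False
      hence ex: "hilfer_deriv_exists \<phi> \<phi>' a b 2 \<mu> \<nu> y" using assms(21) by simp
      have "\<nu> * (2 - \<mu>) > 0" using False assms(8,9) by simp
      hence "\<mu> < \<xi>" using assms(11) by simp
      have "?D t = g t" if "t \<in> {a<..b}" for t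
        unfolding hilfer
        by (rule hilfer_backward_pos[OF \<open>\<mu> < \<xi>\<close> \<xi>(3) assms(7,20) _ _ g y that]) (use ex in \<open>auto simp: hilfer\<close>)
      thus ?thesis using ex by blast
    qed
    have "?D t = f (t, y t, ?D t)" if "t \<in> {a<..b}" for t
      using gf[OF that] unfolding yA[OF that, symmetric] using ex that by metis
    moreover have "(y \<longlongrightarrow> 0) (at_right a)"
      by (rule solution_tendsto_0(2)[OF \<xi>(2,3) assms(7) g y])
    moreover have "y b = (\<Sum>i=1..m. lam i * I (\<delta> i) y (\<tau> i))"
      using boundary[of g "?A g"] y g assms(7) by simp
    ultimately show ?P using ex by blast
  qed
qed

end
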